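(* Consider the problem $\min\{f(x): x\in\Omega\}$ and the stochastic interior-point method with mini-batch estimators (SIPM-ME) described in the context, with input $s_\eta\in(0,1)$. Assume: (a) $\Omega^\circ\neq\emptyset$, and there is a finite $\phi_{\mathrm{low}}$ with $\inf_{x\in\Omega^\circ,\,\mu\in(0,1]}\{f(x)+\mu B(x)\}\ge\phi_{\mathrm{low}}$; (b) for every $s\in(0,1)$ there is a constant $L_1(s)>0$ such that $\|\nabla f(y)-\nabla f(x)\|_x^*\le L_1(s)\|y-x\|_x$ for all $x,y\in\Omega^\circ$ with $\|y-x\|_x\le s$; write $L_1=L_1(s_\eta)$; (c) the estimator $G:\Omega^\circ\times\Xi\to\mathbb{R}^n$ satisfies, for some $\sigma>0$, $\mathbb{E}_\xi[G(x;\xi)]=\nabla f(x)$ and $\mathbb{E}_\xi[(\|G(x;\xi)-\nabla f(x)\|_x^* )^2]\le\sigma^2$ for all $x\in\Omega^\circ$. Let $\epsilon\in(0,1)$ and let the input parameters be, for all $k\ge0$, $$\eta_k=\frac{s_\eta}{(k+1)^{1/2}},\qquad |\mathscr{B}_k|=k+1,\qquad \mu_k=\max\Big\{\frac{1}{(k+1)^{1/2}},\frac{\epsilon}{1+\sqrt{\vartheta}}\Big\}.$$ Let $\kappa(K)$ be uniformly drawn from $\{\lfloor K/2\rfloor,\ldots,K-1\}$, and define $$M_{\mathrm{me}}=2\Big(\frac{\Delta(x^0)}{s_\eta}+8\sigma+s_\eta L_\phi\Big).$$ Then $$\mathbb{E}\big[\|\nabla\phi_{\mu_{\kappa(K)}}(x^{\kappa(K)})+A^T\lambda^{\kappa(K)}\|^*_{x^{\kappa(K)}}\big]\le\mu_{\kappa(K)}\quad\text{with}\quad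 \mu_{\kappa(K)}\le\frac{\epsilon}{1+\sqrt{\vartheta}}$$ for all integers $$K\ge\max\Big\{2\Big(\frac{1+\sqrt{\vartheta}}{\epsilon}\Big)^2,\ \Big(\frac{4M_{\mathrm{me}}(1+\sqrt{\vartheta})}{\epsilon}\ln\Big(\frac{4M_{\mathrm{me}}(1+\sqrt{\vartheta})}{\epsilon}\Big)\Big)^2,\ 3\Big\}.$$
   Context: Setting. $\mathcal{K}\subseteq\mathbb{R}^n$ is a closed pointed convex cone with nonempty interior, $A\in\mathbb{R}^{m\times n}$ has full row rank, $b\in\mathbb{R}^m$, $\Omega=\{x: Ax=b,\ x\in\mathcal{K}\}$, $\Omega^\circ=\{x\in\mathrm{int}\,\mathcal{K}: Ax=b\}$; $f$ is continuously differentiable (possibly nonconvex) on $\Omega$, and $\min_{x\in\Omega}f(x)$ has at least one optimal solution. Barrier. $\mathcal{K}$ is equipped with a $\vartheta$-logarithmically homogeneous self-concordant barrier $B:\mathrm{int}\,\mathcal{K}\to\mathbb{R}$, $\vartheta\ge1$: $B$ is convex and three times continuously differentiable; for $\varphi(t)=B(x+tu)$ one has $|\varphi'''(0)|\le2(\varphi''(0))^{3/2}$ for all $x\in\mathrm{int}\,\mathcal{K}$, $u\in\mathbb{R}^n$; $B(x)\to\infty$ as $x$ approaches the boundary of $\mathcal{K}$; and $B(tx)=B(x)-\vartheta\ln t$ for all $x\in\mathrm{int}\,\mathcal{K}$, $t>0$. For $x\in\mathrm{int}\,\mathcal{K}$ and $v\in\mathbb{R}^n$: $\|v\|_x=(v^T\nabla^2B(x)v)^{1/2}$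 and $\|v\|_x^*=(v^T\nabla^2B(x)^{-1}v)^{1/2}$. Notation. $\phi_\mu(x)=f(x)+\mu(f(x)+B(x))$ for $x\in\Omega^\circ$, $\mu\in(0,1]$. With $[t]_+=\max\{t,0\}$ and $[t]_-=\min\{t,0\}$, $\Delta(x)=f(x)+[f(x)+B(x)]_+-2[\phi_{\mathrm{low}}]_-$, and $L_\phi=2L_1+1/(1-s_\eta)$. Algorithm (SIPM framework). Input: $s_\eta\in(0,1)$, $x^0\in\Omega^\circ$ (deterministic), nonincreasing step sizes $\{\eta_k\}_{k\ge0}\subset(0,s_\eta]$, nonincreasing barrier parameters $\{\mu_k\}_{k\ge0}\subset(0,1]$. For $k=0,1,2,\ldots$: construct an estimator $\overline m^k$ of $\nabla f(x^k)$, set $m^k=\overline m^k+\mu_k(\overline m^k+\nabla B(x^k))$, $H_k=\nabla^2B(x^k)^{-1}$, $$\lambda^k=-(AH_kA^T)^{-1}AH_km^k,\qquad x^{k+1}=x^k-\eta_k\frac{H_k(m^k+A^T\lambda^k)}{\|m^k+A^T\lambda^k\|^*_{x^k}}.$$ The update is understood to be well defined, i.e. $m^k+A^T\lambda^k\ne0$ for all $k$. SIPM-ME is this framework with $\overline m^k=\frac{1}{|\mathscr{B}_k|}\sum_{i\in\mathscr{B}_k}G(x^k;\xi_i^k)$, where $\mathscr{B}_k$ is a finite nonempty index set and all $\xi_i^k$ are independent copies of the random variable $\xi$ (with sample space $\Xi$). The draw of $\kappa(K)$ is independent of the samples; $\mathbb{E}$ is expectation over all randomness. *)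

theory Defs
  imports "HOL-Probability.Probability"
begin

definition grad :: "(real^'n \<Rightarrow> real) \<Rightarrow> real^'n \<Rightarrow> real^'n" where
  "grad f x = (THE g. GDERIV f x :> g)"

definition hess :: "(real^'n \<Rightarrow> real) \<Rightarrow> real^'n \<Rightarrow> real^'n^'n" where
  "hess f x = jacobian (grad f) (at x)"

text \<open>
  \<open>C_diff_on k f S\<close>: \<open>f\<close> is \<open>k\<close> times continuously differentiable on \<open>S\<close>. The derivatives
  are those of the ambient space, taken at the points of \<open>S\<close>. In finite dimension, continuity
  of the derivative is the same as continuity of all directional derivatives.
\<close>
primrec C_diff_on ::
    "nat \<Rightarrow> ('a::euclidean_space \<Rightarrow> 'b::real_normed_vector) \<Rightarrow> 'a set \<Rightarrow> bool" where
  "C_diff_on 0 f S \<longleftrightarrow> continuous_on S f"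
| "C_diff_on (Suc k) f S \<longleftrightarrow>
     (\<forall>x\<in>S. f differentiable (at x)) \<and>
     (\<forall>h. C_diff_on k (\<lambda>x. frechet_derivative f (at x) h) S)"

definition proper_cone :: "(real^'n) set \<Rightarrow> bool" where
  "proper_cone K \<longleftrightarrow>
     closed K \<and> convex K \<and> cone K \<and> (\<forall>x. x \<in> K \<and> - x \<in> K \<longrightarrow> x = 0) \<and> interior K \<noteq> {}"

definition feasible :: "(real^'n) set \<Rightarrow> real^'n^'m \<Rightarrow> real^'m \<Rightarrow> (real^'n) set" where
  "feasible K A b = {x. A *v x = b \<and> x \<in> K}"

definition strictly_feasible :: "(real^'n) set \<Rightarrow> real^'n^'m \<Rightarrow> real^'m \<Rightarrow> (real^'n) set" where
  "strictly_feasible K A b = {x \<in> interior K. A *v x = b}"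

definition LHSC_barrier :: "(real^'n) set \<Rightarrow> real \<Rightarrow> (real^'n \<Rightarrow> real) \<Rightarrow> bool" where
  "LHSC_barrier K \<theta> B \<longleftrightarrow>
     convex_on (interior K) B \<and>
     C_diff_on 3 B (interior K) \<and>
     (\<forall>x\<in>interior K. \<forall>u.
        let \<phi> = (\<lambda>t::real. B (x + t *\<^sub>R u))
        in \<bar>(deriv ^^ 3) \<phi> 0\<bar> \<le> 2 * ((deriv ^^ 2) \<phi> 0) powr (3/2)) \<and>
     (\<forall>z\<in>frontier K. filterlim B at_top (at z within interior K)) \<and>
     (\<forall>x\<in>interior K. \<forall>t>0. B (t *\<^sub>R x) = B x - \<theta> * ln t)"

definition local_norm :: "(real^'n \<Rightarrow> real) \<Rightarrow> real^'n \<Rightarrow> real^'n \<Rightarrow> real" where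
  "local_norm B x v = sqrt (v \<bullet> (hess B x *v v))"

definition dual_norm :: "(real^'n \<Rightarrow> real) \<Rightarrow> real^'n \<Rightarrow> real^'n \<Rightarrow> real" where
  "dual_norm B x v = sqrt (v \<bullet> (matrix_inv (hess B x) *v v))"

definition barrier_fun :: "(real^'n \<Rightarrow> real) \<Rightarrow> (real^'n \<Rightarrow> real) \<Rightarrow> real \<Rightarrow> real^'n \<Rightarrow> real" where
  "barrier_fun f B \<mu> x = f x + \<mu> * (f x + B x)"

definition init_gap :: "(real^'n \<Rightarrow> real) \<Rightarrow> (real^'n \<Rightarrow> real) \<Rightarrow> real \<Rightarrow> real^'n \<Rightarrow> real" where
  "init_gap f B \<phi>low x = f x + max (f x + B x) 0 - 2 * min \<phi>low 0"

text \<open>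
  One realisation of the method: \<open>mbar\<close> is the sequence of gradient estimates, and \<open>m\<close>, \<open>lam\<close>,
  \<open>x\<close> are the momenta, multipliers and iterates that it produces. The normalisation divides by
  the dual norm of \<open>m k + transpose A *v lam k\<close>; that this vector is nonzero is not part of the
  predicate and has to be assumed separately.
\<close>
definition SIPM_run ::
    "real^'n^'m \<Rightarrow> (real^'n \<Rightarrow> real) \<Rightarrow> (nat \<Rightarrow> real) \<Rightarrow> (nat \<Rightarrow> real) \<Rightarrow> real^'n \<Rightarrow>
     (nat \<Rightarrow> real^'n) \<Rightarrow> (nat \<Rightarrow> real^'n) \<Rightarrow> (nat \<Rightarrow> real^'m) \<Rightarrow> (nat \<Rightarrow> real^'n) \<Rightarrow> bool" where
  "SIPM_run A B \<eta> \<mu> x0 mbar m lam x \<longleftrightarrow>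
     x 0 = x0 \<and>
     (\<forall>k. let H = matrix_inv (hess B (x k));
              d = m k + transpose A *v lam k
          in m k = mbar k + \<mu> k *\<^sub>R (mbar k + grad B (x k)) \<and>
             lam k = - (matrix_inv (A ** H ** transpose A) *v (A *v (H *v m k))) \<and>
             x (Suc k) = x k - \<eta> k *\<^sub>R ((1 / dual_norm B (x k) d) *\<^sub>R (H *v d)))"

definition minibatch ::
    "(real^'n \<Rightarrow> 's \<Rightarrow> real^'n) \<Rightarrow> 'i set \<Rightarrow> ('i \<Rightarrow> 's) \<Rightarrow> real^'n \<Rightarrow> real^'n" where
  "minibatch G I \<xi> x = (1 / real (card I)) *\<^sub>R (\<Sum>i\<in>I. G x (\<xi> i))"

end

theory Submission
  imports Defs
begin

text \<open>
  Self-concordance bounds the second derivative of \<open>B\<close> along a segment, so \<open>B\<close> cannot blow up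
  inside the Dikin ellipsoid: a step of local length at most \<open>s\<eta> < 1\<close> stays strictly feasible,
  and there \<open>\<phi>\<^sub>\<mu>\<close> has a quadratic upper bound with constant \<open>L\<phi>\<close>. The same
  bound with a degenerate direction would produce a line inside the cone, so the Hessian is positive
  definite. The step is orthogonal to the range of \<open>A\<^sup>T\<close>, hence
  \<open>\<phi>\<^sub>\<mu>\<close> decreases by \<open>\<eta>\<close> times the stationarity residual, up to
  \<open>4\<eta>\<close> times the error of the gradient estimate and \<open>L\<phi> \<eta>\<^sup>2 / 2\<close>. These
  inequalities are summed path by path. In expectation the error of a batch of size \<open>k + 1\<close> is at
  most \<open>\<sigma> / sqrt (k + 1)\<close>, so both error sums are harmonic, and averaging over the last half
  of the iterations gives a residual of order \<open>ln N / sqrt N\<close>.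
\<close>

section \<open>Norms of positive definite matrices\<close>

text \<open>Two difficulties shape the argument. The barrier parameter changes from step to step;
  since \<open>\<phi>\<^sub>\<mu> = f + \<mu> (f + B)\<close>, lowering it by \<open>d\<close>
  changes the objective by \<open>- d (f + B)\<close>. The lower bound at parameter 1 controls this
  loss, and the losses telescope together with the final lower bound into the term
  \<open>- 2 * min \<phi>low 0\<close> of the initial gap. Moreover, neither measurability of the
  iterates nor integrability of the residuals is given. The iterates are therefore written as
  deterministic functions of the array of all samples, so that independence of past and present
  concerns disjoint coordinates of a product space. Measurability comes from continuity of the
  ingredients of a step on the strictly feasible set, in particular of the inverse Hessian and of
  the inverse of \<open>A H A\<^sup>T\<close>; integrability of the residuals comes from the
  pathwise bound itself. Local norms vary with the point, but all estimates for one step use the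
  norm at the current iterate; the only comparison of Hessians at different points is the growth
  bound along a single line.\<close>

definition quad_norm :: "real^'n^'n \<Rightarrow> real^'n \<Rightarrow> real" where
  "quad_norm Q v = sqrt (v \<bullet> (Q *v v))"

definition sym_pd :: "real^'n^'n \<Rightarrow> bool" where
  "sym_pd Q \<longleftrightarrow> transpose Q = Q \<and> (\<forall>v. v \<noteq> 0 \<longrightarrow> 0 < v \<bullet> (Q *v v))"

lemma inner_matrix_transpose:
  fixes A :: "real^'n^'m"
  shows "u \<bullet> (A *v v) = (transpose A *v u) \<bullet> v"
  by (simp add: dot_lmul_matrix)

lemma sym_pd_swap: "sym_pd Q \<Longrightarrow> u \<bullet> (Q *v v) = v \<bullet> (Q *v u)"
  by (metis inner_commute inner_matrix_transpose sym_pd_def)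

lemma sym_pd_nonneg: "sym_pd Q \<Longrightarrow> 0 \<le> v \<bullet> (Q *v v)"
  by (cases "v = 0") (auto simp: sym_pd_def less_imp_le)

lemma quad_norm_nonneg: "sym_pd Q \<Longrightarrow> 0 \<le> quad_norm Q v"
  by (simp add: quad_norm_def sym_pd_nonneg)

lemma quad_norm_square: "sym_pd Q \<Longrightarrow> (quad_norm Q v)\<^sup>2 = v \<bullet> (Q *v v)"
  by (simp add: quad_norm_def sym_pd_nonneg)

lemma quad_norm_scaleR: "quad_norm Q (c *\<^sub>R v) = \<bar>c\<bar> * quad_norm Q v"
proof -
  have "(c *\<^sub>R v) \<bullet> (Q *v (c *\<^sub>R v)) = c\<^sup>2 * (v \<bullet> (Q *v v))"
    by (simp add: matrix_vector_mult_scaleR power2_eq_square)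
  then show ?thesis by (simp add: quad_norm_def real_sqrt_mult)
qed

lemma quad_expand:
  assumes "sym_pd Q"
  shows "(u + v) \<bullet> (Q *v (u + v)) = u \<bullet> (Q *v u) + 2 * (u \<bullet> (Q *v v)) + v \<bullet> (Q *v v)"
  using sym_pd_swap[OF assms, of u v]
  by (simp add: matrix_vector_right_distrib inner_add_left inner_add_right)

lemma quad_Cauchy_Schwarz:
  assumes "sym_pd Q"
  shows "\<bar>u \<bullet> (Q *v v)\<bar> \<le> quad_norm Q u * quad_norm Q v"
proof (cases "v = 0")
  case False
  define a b c where "a = v \<bullet> (Q *v v)" and "b = u \<bullet> (Q *v v)" and "c = u \<bullet> (Q *v u)"
  have a: "0 < a" using assms False by (simp add: a_def sym_pd_def)
  \<comment> \<open>The coefficient \<open>- (b / a)\<close> minimises the form along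
    \<open>v\<close>; nonnegativity of the minimum \<open>c - b\<^sup>2 / a\<close> is the
    claim.\<close>
  have "0 \<le> (u + (- (b / a)) *\<^sub>R v) \<bullet> (Q *v (u + (- (b / a)) *\<^sub>R v))"
    by (rule sym_pd_nonneg[OF assms])
  also have "\<dots> = c - b\<^sup>2 / a"
    unfolding quad_expand[OF assms] using a
    by (simp add: matrix_vector_mult_scaleR a_def[symmetric] b_def[symmetric] c_def[symmetric]
        field_simps power2_eq_square linear_neg[OF matrix_vector_mul_linear])
  finally have "b\<^sup>2 \<le> c * a" using a by (simp add: field_simps)
  then have "sqrt (b\<^sup>2) \<le> sqrt (c * a)" by (rule real_sqrt_le_mono)
  then show ?thesis
    by (simp add: quad_norm_def a_def b_def c_def real_sqrt_mult)
qed (simp add: quad_norm_def)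

lemma quad_norm_triangle:
  assumes "sym_pd Q"
  shows "quad_norm Q (u + v) \<le> quad_norm Q u + quad_norm Q v"
proof (rule power2_le_imp_le)
  show "(quad_norm Q (u + v))\<^sup>2 \<le> (quad_norm Q u + quad_norm Q v)\<^sup>2"
    using quad_Cauchy_Schwarz[OF assms, of u v]
    by (simp add: quad_norm_square[OF assms] power2_sum quad_expand[OF assms])
qed (simp add: quad_norm_nonneg[OF assms])

lemma kernel_trivial_imp_invertible:
  fixes A :: "real^'n^'n"
  assumes "\<And>v. A *v v = 0 \<Longrightarrow> v = 0"
  shows "invertible A"
  using assms by (metis invertible_left_inverse matrix_left_invertible_ker)

lemma sym_pd_invertible: "sym_pd Q \<Longrightarrow> invertible Q"
  by (rule kernel_trivial_imp_invertible) (metis inner_zero_right less_irrefl sym_pd_def)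

lemma matrix_inv_mult_vector:
  assumes "invertible (Q :: real^'n^'n)"
  shows "Q *v (matrix_inv Q *v v) = v" "matrix_inv Q *v (Q *v v) = v"
proof -
  have "Q ** matrix_inv Q = mat 1 \<and> matrix_inv Q ** Q = mat 1"
    using assms unfolding invertible_def matrix_inv_def by (rule someI_ex)
  then show "Q *v (matrix_inv Q *v v) = v" "matrix_inv Q *v (Q *v v) = v"
    by (simp_all add: matrix_vector_mul_assoc)
qed

lemma sym_pd_matrix_inv:
  assumes Q: "sym_pd (Q :: real^'n^'n)"
  shows "sym_pd (matrix_inv Q)"
  unfolding sym_pd_def
proof safe
  note inv = matrix_inv_mult_vector[OF sym_pd_invertible[OF Q]]
  have swap: "u \<bullet> (matrix_inv Q *v v) = v \<bullet> (matrix_inv Q *v u)" for u v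
    using sym_pd_swap[OF Q, of "matrix_inv Q *v u" "matrix_inv Q *v v"]
    by (simp add: inv inner_commute)
  have "transpose (matrix_inv Q) *v u = matrix_inv Q *v u" for u
  proof (rule vector_eq_ldot[THEN iffD1], rule allI)
    fix w
    show "w \<bullet> (transpose (matrix_inv Q) *v u) = w \<bullet> (matrix_inv Q *v u)"
      by (metis inner_commute inner_matrix_transpose swap)
  qed
  then show "transpose (matrix_inv Q) = matrix_inv Q"
    by (simp add: matrix_eq)
  fix v :: "real^'n" assume v: "v \<noteq> 0"
  then have "matrix_inv Q *v v \<noteq> 0" by (metis inv(1) matrix_vector_mult_0_right)
  then have "0 < (matrix_inv Q *v v) \<bullet> (Q *v (matrix_inv Q *v v))"
    using Q by (simp add: sym_pd_def)
  then show "0 < v \<bullet> (matrix_inv Q *v v)" by (simp add: inv inner_commute)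
qed

lemma quad_norm_inverse_image:
  assumes Q: "sym_pd (Q :: real^'n^'n)"
  shows "quad_norm Q (matrix_inv Q *v d) = quad_norm (matrix_inv Q) d"
  by (simp add: quad_norm_def matrix_inv_mult_vector[OF sym_pd_invertible[OF Q]] inner_commute)

text \<open>The Euclidean pairing is the \<open>Q\<close>-inner product of
  \<open>matrix_inv Q *v v\<close> with \<open>p\<close>, and the first of these has
  \<open>Q\<close>-norm equal to the dual norm of \<open>v\<close>. So this is Cauchy-Schwarz for
  \<open>Q\<close>.\<close>

lemma quad_dual_pairing:
  assumes Q: "sym_pd (Q :: real^'n^'n)"
  shows "\<bar>v \<bullet> p\<bar> \<le> quad_norm (matrix_inv Q) v * quad_norm Q p"
proof -
  have "(matrix_inv Q *v v) \<bullet> (Q *v p) = v \<bullet> p"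
    by (metis Q inner_commute matrix_inv_mult_vector(1) sym_pd_invertible sym_pd_swap)
  then show ?thesis
    using quad_Cauchy_Schwarz[OF Q, of "matrix_inv Q *v v" p]
    by (simp add: quad_norm_inverse_image[OF Q])
qed

text \<open>Pairing a kernel vector \<open>y\<close> with its image gives the \<open>Q\<close>-form
  of \<open>transpose A *v y\<close>, so that vector is 0, and full row rank makes the transpose
  injective. This is what makes the multiplier a true solution of the normal equations.\<close>

lemma normal_matrix_invertible:
  fixes A :: "real^'n^'m"
  assumes rk: "rank A = CARD('m)" and Q: "sym_pd Q"
  shows "invertible (A ** Q ** transpose A)"
proof (rule kernel_trivial_imp_invertible)
  fix y assume "(A ** Q ** transpose A) *v y = 0"
  then have "A *v (Q *v (transpose A *v y)) = 0"
    by (simp add: matrix_vector_mul_assoc[symmetric] del: transpose_matrix_vector)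
  then have "(transpose A *v y) \<bullet> (Q *v (transpose A *v y)) = 0"
    by (metis inner_matrix_transpose inner_zero_right)
  then have "transpose A *v y = 0" using Q unfolding sym_pd_def by (metis less_irrefl)
  moreover have "inj ((*v) (transpose A))"
    using rk by (simp only: full_rank_injective[symmetric] rank_transpose)
  ultimately show "y = 0"
    by (metis inj_eq matrix_vector_mult_0_right)
qed

section \<open>Calculus\<close>

text \<open>The mean value theorem is used twice: along \<open>h\<close> for the increment of
  \<open>f\<close> in direction \<open>k\<close>, then along \<open>k\<close> for the
  \<open>h\<close>-derivative. The second difference on the left is symmetric in \<open>h\<close>
  and \<open>k\<close>, whence the symmetry of second derivatives.\<close>

lemma mixed_difference:
  fixes f :: "'a::real_normed_vector \<Rightarrow> real"
  assumes s: "0 < s"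
    and U: "\<And>a b. 0 \<le> a \<Longrightarrow> a \<le> s \<Longrightarrow> 0 \<le> b \<Longrightarrow> b \<le> s \<Longrightarrow> x + a *\<^sub>R h + b *\<^sub>R k \<in> U"
    and f: "\<And>y. y \<in> U \<Longrightarrow> (f has_derivative D y) (at y)"
    and D: "\<And>y. y \<in> U \<Longrightarrow> ((\<lambda>y. D y h) has_derivative E y) (at y)"
  shows "\<exists>a b. 0 \<le> a \<and> a \<le> s \<and> 0 \<le> b \<and> b \<le> s \<and>
    f (x + s *\<^sub>R h + s *\<^sub>R k) - f (x + s *\<^sub>R h) - f (x + s *\<^sub>R k) + f x
      = s\<^sup>2 * E (x + a *\<^sub>R h + b *\<^sub>R k) k"
proof -
  have g: "((\<lambda>a. f (x + a *\<^sub>R h + b *\<^sub>R k)) has_real_derivative D (x + a *\<^sub>R h + b *\<^sub>R k) h) (at a)"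
    if "0 \<le> a" "a \<le> s" "0 \<le> b" "b \<le> s" for a b
  proof -
    have "((\<lambda>a. x + a *\<^sub>R h + b *\<^sub>R k) has_derivative (\<lambda>r. r *\<^sub>R h)) (at a)"
      by (auto intro!: derivative_eq_intros)
    from has_derivative_compose[OF this f[OF U[OF that]]]
    have "((\<lambda>a. f (x + a *\<^sub>R h + b *\<^sub>R k)) has_derivative (\<lambda>r. D (x + a *\<^sub>R h + b *\<^sub>R k) (r *\<^sub>R h))) (at a)"
      by simp
    moreover have "D (x + a *\<^sub>R h + b *\<^sub>R k) (r *\<^sub>R h) = D (x + a *\<^sub>R h + b *\<^sub>R k) h * r" for r
      using linear_scale[OF has_derivative_linear[OF f[OF U[OF that]]]] by simp
    ultimately show ?thesis by (simp add: has_field_derivative_def)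
  qed
  define g where "g a = f (x + a *\<^sub>R h + s *\<^sub>R k) - f (x + a *\<^sub>R h + 0 *\<^sub>R k)" for a
  have "\<exists>a>0. a < s \<and> g s - g 0 = (s - 0) * (D (x + a *\<^sub>R h + s *\<^sub>R k) h - D (x + a *\<^sub>R h + 0 *\<^sub>R k) h)"
    using s unfolding g_def
    by (intro MVT2) (auto intro!: DERIV_diff g[of _ s] g[of _ 0] simp del: scaleR_zero_left)
  then obtain a where a: "0 < a" "a < s"
    and ga: "g s - g 0 = s * (D (x + a *\<^sub>R h + s *\<^sub>R k) h - D (x + a *\<^sub>R h + 0 *\<^sub>R k) h)" by auto
  have e: "((\<lambda>b. D (x + a *\<^sub>R h + b *\<^sub>R k) h) has_real_derivative E (x + a *\<^sub>R h + b *\<^sub>R k) k) (at b)"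
    if b: "0 \<le> b" "b \<le> s" for b
  proof -
    have u: "x + a *\<^sub>R h + b *\<^sub>R k \<in> U" using U a b by auto
    have "((\<lambda>b. x + a *\<^sub>R h + b *\<^sub>R k) has_derivative (\<lambda>r. r *\<^sub>R k)) (at b)"
      by (auto intro!: derivative_eq_intros)
    from has_derivative_compose[OF this D[OF u]]
    have "((\<lambda>b. D (x + a *\<^sub>R h + b *\<^sub>R k) h) has_derivative (\<lambda>r. E (x + a *\<^sub>R h + b *\<^sub>R k) (r *\<^sub>R k))) (at b)"
      by simp
    moreover have "E (x + a *\<^sub>R h + b *\<^sub>R k) (r *\<^sub>R k) = E (x + a *\<^sub>R h + b *\<^sub>R k) k * r" for r
      using linear_scale[OF has_derivative_linear[OF D[OF u]]] by simp
    ultimately show ?thesis by (simp add: has_field_derivative_def)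
  qed
  have "\<exists>b>0. b < s \<and> D (x + a *\<^sub>R h + s *\<^sub>R k) h - D (x + a *\<^sub>R h + 0 *\<^sub>R k) h
      = (s - 0) * E (x + a *\<^sub>R h + b *\<^sub>R k) k"
    using s by (intro MVT2) (auto intro!: e)
  then obtain b where b: "0 < b" "b < s"
    "D (x + a *\<^sub>R h + s *\<^sub>R k) h - D (x + a *\<^sub>R h + 0 *\<^sub>R k) h = s * E (x + a *\<^sub>R h + b *\<^sub>R k) k"
    by auto
  have "g s - g 0 = s\<^sup>2 * E (x + a *\<^sub>R h + b *\<^sub>R k) k"
    unfolding ga b(3) by (simp add: power2_eq_square)
  then show ?thesis using a b
    by (intro exI[of _ a] exI[of _ b]) (simp add: g_def)
qed

lemma second_derivative_symmetric:
  fixes f :: "'a::real_normed_vector \<Rightarrow> real"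
  assumes U: "open U" "x \<in> U"
    and f: "\<And>y. y \<in> U \<Longrightarrow> (f has_derivative D y) (at y)"
    and Dh: "\<And>y. y \<in> U \<Longrightarrow> ((\<lambda>y. D y h) has_derivative E y) (at y)"
    and Dk: "\<And>y. y \<in> U \<Longrightarrow> ((\<lambda>y. D y k) has_derivative F y) (at y)"
    and E: "isCont (\<lambda>y. E y k) x" and F: "isCont (\<lambda>y. F y h) x"
  shows "E x k = F x h"
proof (rule ccontr)
  assume ne: "E x k \<noteq> F x h"
  \<comment> \<open>Half the gap, so that two deviations below \<open>e\<close> cannot bridge
    it.\<close>
  define e where "e = \<bar>E x k - F x h\<bar> / 2"
  have e: "0 < e" using ne by (simp add: e_def)
  obtain d1 where d1: "0 < d1" "\<And>y. dist y x < d1 \<Longrightarrow> \<bar>E y k - E x k\<bar> < e"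
    using E e unfolding continuous_at_eps_delta dist_real_def by blast
  obtain d2 where d2: "0 < d2" "\<And>y. dist y x < d2 \<Longrightarrow> \<bar>F y h - F x h\<bar> < e"
    using F e unfolding continuous_at_eps_delta dist_real_def by blast
  obtain d3 where d3: "0 < d3" "ball x d3 \<subseteq> U" using U open_contains_ball by blast
  define d where "d = Min {d1, d2, d3}"
  have d: "0 < d" "d \<le> d1" "d \<le> d2" "d \<le> d3" using d1 d2 d3 by (auto simp: d_def)
  \<comment> \<open>The parallelogram with sides \<open>s *\<^sub>R h\<close> and
    \<open>s *\<^sub>R k\<close> then fits into the ball of radius \<open>d\<close>; the summand 1
    keeps the denominator positive and the inclusion strict.\<close>
  define s where "s = d / (norm h + norm k + 1)"
  have nn: "0 < norm h + norm k + 1"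
    using norm_ge_zero[of h] norm_ge_zero[of k] by linarith
  have s: "0 < s" using d nn by (simp add: s_def)
  have near: "dist (x + a *\<^sub>R h + b *\<^sub>R k) x < d" if "0 \<le> a" "a \<le> s" "0 \<le> b" "b \<le> s" for a b
  proof -
    have "dist (x + a *\<^sub>R h + b *\<^sub>R k) x = norm (a *\<^sub>R h + b *\<^sub>R k)" by (simp add: dist_norm)
    also have "\<dots> \<le> a * norm h + b * norm k" using norm_triangle_ineq[of "a *\<^sub>R h" "b *\<^sub>R k"] that by simp
    also have "\<dots> \<le> s * norm h + s * norm k" using that by (intro add_mono mult_right_mono) auto
    also have "\<dots> < s * (norm h + norm k + 1)" using s by (simp add: algebra_simps)
    also have "\<dots> = d" using nn by (simp add: s_def)
    finally show ?thesis .
  qed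
  have inU: "x + a *\<^sub>R h + b *\<^sub>R k \<in> U" if "0 \<le> a" "a \<le> s" "0 \<le> b" "b \<le> s" for a b
    using near[OF that] d d3 by (auto simp: subset_iff dist_commute)
  obtain a b where ab: "0 \<le> a" "a \<le> s" "0 \<le> b" "b \<le> s"
    and 1: "f (x + s *\<^sub>R h + s *\<^sub>R k) - f (x + s *\<^sub>R h) - f (x + s *\<^sub>R k) + f x
      = s\<^sup>2 * E (x + a *\<^sub>R h + b *\<^sub>R k) k"
    using mixed_difference[where U=U, OF s inU f Dh] by blast
  have inU': "x + a *\<^sub>R k + b *\<^sub>R h \<in> U" if "0 \<le> a" "a \<le> s" "0 \<le> b" "b \<le> s" for a b
    using inU[OF that(3,4,1,2)] by (simp add: add_ac)
  obtain a' b' where ab': "0 \<le> a'" "a' \<le> s" "0 \<le> b'" "b' \<le> s"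
    and 2: "f (x + s *\<^sub>R k + s *\<^sub>R h) - f (x + s *\<^sub>R k) - f (x + s *\<^sub>R h) + f x
      = s\<^sup>2 * F (x + a' *\<^sub>R k + b' *\<^sub>R h) h"
    using mixed_difference[where U=U, OF s inU' f Dk] by blast
  have "s\<^sup>2 * E (x + a *\<^sub>R h + b *\<^sub>R k) k = s\<^sup>2 * F (x + a' *\<^sub>R k + b' *\<^sub>R h) h"
    using 1 2 by (simp only: add_ac diff_diff_eq add.commute[of "s *\<^sub>R k"])
  then have "E (x + a *\<^sub>R h + b *\<^sub>R k) k = F (x + a' *\<^sub>R k + b' *\<^sub>R h) h" using s by simp
  moreover have "\<bar>E (x + a *\<^sub>R h + b *\<^sub>R k) k - E x k\<bar> < e"
    using near[OF ab] d by (intro d1) auto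
  moreover have "\<bar>F (x + a' *\<^sub>R k + b' *\<^sub>R h) h - F x h\<bar> < e"
    using near[OF ab'(3,4,1,2)] d by (intro d2) (auto simp: add_ac)
  ultimately show False unfolding e_def by (smt (verit) field_sum_of_halves)
qed

text \<open>Adding the tangent inequalities at two points shows that \<open>\<phi>'\<close> is
  monotone, so its derivative cannot be negative.\<close>

lemma convex_on_second_deriv_nonneg:
  fixes \<phi> :: "real \<Rightarrow> real"
  assumes c: "convex_on {a<..<b} \<phi>" and t: "a < t" "t < b"
    and d1: "\<And>s. a < s \<Longrightarrow> s < b \<Longrightarrow> (\<phi> has_real_derivative \<phi>' s) (at s)"
    and d2: "(\<phi>' has_real_derivative l) (at t)"
  shows "0 \<le> l"
proof -
  have "\<phi>' s \<le> \<phi>' r" if "a < s" "s \<le> r" "r < b" for s r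
  proof (cases "s = r")
    case False
    have w: "(\<phi> has_real_derivative \<phi>' z) (at z within {a<..<b})" if "a < z" "z < b" for z
      using d1[OF that] by (rule has_field_derivative_at_within)
    have "\<phi> r - \<phi> s \<ge> \<phi>' s * (r - s)" "\<phi> s - \<phi> r \<ge> \<phi>' r * (s - r)"
      using that by (auto intro!: convex_on_imp_above_tangent[OF c]
          intro!: w simp: interior_open)
    then have "0 \<le> (\<phi>' r - \<phi>' s) * (r - s)" by (simp add: algebra_simps)
    then show ?thesis using that False by (simp add: zero_le_mult_iff)
  qed simp
  then have "mono_on {a<..<b} \<phi>'" by (auto intro!: mono_onI)
  then show ?thesis using t d2
    by (intro mono_on_imp_deriv_nonneg[where A="{a<..<b}" and f=\<phi>' and x=t]) (auto simp: interior_open)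
qed

text \<open>Adding \<open>\<delta>\<close> makes \<open>g\<close> positive, so that \<open>1 / sqrt (g + \<delta>)\<close> is \<open>1\<close>-Lipschitz; letting
  \<open>\<delta>\<close> tend to \<open>0\<close> then covers the degenerate case \<open>g 0 = 0\<close> as well.\<close>
lemma self_concordant_growth:
  fixes g :: "real \<Rightarrow> real"
  assumes t: "0 \<le> t" and r: "t * sqrt (g 0) < 1"
    and g0: "\<And>s. 0 \<le> s \<Longrightarrow> s \<le> t \<Longrightarrow> 0 \<le> g s"
    and dg: "\<And>s. 0 \<le> s \<Longrightarrow> s \<le> t \<Longrightarrow> (g has_real_derivative g' s) (at s)"
    and sc: "\<And>s. 0 \<le> s \<Longrightarrow> s \<le> t \<Longrightarrow> \<bar>g' s\<bar> \<le> 2 * g s powr (3/2)"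
  shows "sqrt (g t) \<le> sqrt (g 0) / (1 - t * sqrt (g 0))"
proof -
  have main: "sqrt (g t) \<le> sqrt (g 0 + \<delta>) / (1 - t * sqrt (g 0 + \<delta>))"
    if \<delta>: "0 < \<delta>" and small: "t * sqrt (g 0 + \<delta>) < 1" for \<delta>
  proof -
    define q where "q s = 1 / sqrt (g s + \<delta>) + s" for s
    have "q 0 \<le> q t"
    proof (rule DERIV_nonneg_imp_nondecreasing[OF t])
      fix s assume s: "0 \<le> s" "s \<le> t"
      define w where "w = sqrt (g s + \<delta>)"
      have w: "0 < w" and w2: "w\<^sup>2 = g s + \<delta>" using g0[OF s] \<delta> by (auto simp: w_def)
      have pos: "0 < g s + \<delta>" using g0[OF s] \<delta> by auto
      have dq: "(q has_real_derivative (- (g' s / (2 * w)) / w\<^sup>2 + 1)) (at s)"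
        unfolding q_def w_def using pos w s
        by (auto intro!: derivative_eq_intros dg simp: w_def[symmetric] power2_eq_square field_simps)
      have "g s powr (3/2) \<le> (g s + \<delta>) powr (3/2)"
        using g0[OF s] \<delta> by (intro powr_mono2) auto
      also have "\<dots> = w ^ 3"
      proof -
        have "(g s + \<delta>) powr (3/2) = (w powr 2) powr (3/2)" using w w2 by (simp add: powr_numeral)
        also have "\<dots> = w ^ 3" unfolding powr_powr using w by (simp add: powr_numeral)
        finally show ?thesis .
      qed
      finally have "g' s \<le> 2 * w ^ 3" using sc[OF s] by linarith
      then have "g' s / (2 * w) / w\<^sup>2 \<le> 1"
        using w by (simp add: divide_simps power3_eq_cube power2_eq_square mult_ac)
      then show "\<exists>y. (q has_real_derivative y) (at s) \<and> 0 \<le> y"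
        using dq by (intro exI[of _ "- (g' s / (2 * w)) / w\<^sup>2 + 1"]) auto
    qed
    then have "1 / sqrt (g 0 + \<delta>) - t \<le> 1 / sqrt (g t + \<delta>)" by (simp add: q_def)
    moreover have p: "0 < sqrt (g 0 + \<delta>)" "0 < sqrt (g t + \<delta>)" using g0[of 0] g0[of t] t \<delta> by auto
    ultimately have "sqrt (g t + \<delta>) * (1 - t * sqrt (g 0 + \<delta>)) \<le> sqrt (g 0 + \<delta>)"
      by (simp add: field_simps)
    then have "sqrt (g t + \<delta>) \<le> sqrt (g 0 + \<delta>) / (1 - t * sqrt (g 0 + \<delta>))"
      using small by (simp add: pos_le_divide_eq)
    moreover have "sqrt (g t) \<le> sqrt (g t + \<delta>)" using \<delta> by simp
    ultimately show ?thesis by linarith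
  qed
  have lim: "((\<lambda>\<delta>. t * sqrt (g 0 + \<delta>)) \<longlongrightarrow> t * sqrt (g 0 + 0)) (at_right 0)"
    by (intro tendsto_intros)
  have ev: "\<forall>\<^sub>F \<delta> in at_right 0. t * sqrt (g 0 + \<delta>) < 1"
    using order_tendstoD(2)[OF lim, of 1] r by simp
  have "((\<lambda>\<delta>. sqrt (g 0 + \<delta>) / (1 - t * sqrt (g 0 + \<delta>))) \<longlongrightarrow>
      sqrt (g 0 + 0) / (1 - t * sqrt (g 0 + 0))) (at_right 0)"
    using r by (intro tendsto_intros) auto
  then have "sqrt (g t) \<le> sqrt (g 0 + 0) / (1 - t * sqrt (g 0 + 0))"
  proof (rule tendsto_lowerbound)
    show "\<forall>\<^sub>F \<delta> in at_right 0. sqrt (g t) \<le> sqrt (g 0 + \<delta>) / (1 - t * sqrt (g 0 + \<delta>))"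
      using ev eventually_at_right_less[of 0] by eventually_elim (rule main)
  qed simp
  then show ?thesis by simp
qed

text \<open>The comparison function \<open>r\<^sup>2 s\<^sup>2 / (2 (1 - r s))\<close> has second derivative
  \<open>r\<^sup>2 / (1 - r s)\<^sup>3\<close>, which dominates the bound \<open>r\<^sup>2 / (1 - r s)\<^sup>2\<close> on that of \<open>\<phi>\<close>.\<close>
lemma quadratic_upper_bound:
  fixes \<phi> :: "real \<Rightarrow> real"
  assumes t: "0 \<le> t" and r: "0 \<le> r" "t * r < 1"
    and d1: "\<And>s. 0 \<le> s \<Longrightarrow> s \<le> t \<Longrightarrow> (\<phi> has_real_derivative \<phi>' s) (at s)"
    and d2: "\<And>s. 0 \<le> s \<Longrightarrow> s \<le> t \<Longrightarrow> (\<phi>' has_real_derivative \<phi>'' s) (at s)"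
    and bd: "\<And>s. 0 \<le> s \<Longrightarrow> s \<le> t \<Longrightarrow> \<phi>'' s \<le> (r / (1 - s * r))\<^sup>2"
  shows "\<phi> t \<le> \<phi> 0 + t * \<phi>' 0 + (t * r)\<^sup>2 / (2 * (1 - t * r))"
proof -
  have sr: "s * r < 1" if "0 \<le> s" "s \<le> t" for s
    using mult_right_mono[of s t r] that r by linarith
  \<comment> \<open>The derivative of the comparison function: with \<open>w = 1 - s * r\<close>
    that function equals \<open>(1 / w - 2 + w) / 2\<close>.\<close>
  define q' where "q' s = r / 2 * (1 / (1 - s * r)\<^sup>2 - 1)" for s
  have q_mono: "\<phi>' s - q' s \<le> \<phi>' 0 - q' 0" if s: "0 \<le> s" "s \<le> t" for s
  proof (rule DERIV_nonpos_imp_nonincreasing[OF s(1)])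
    fix z assume z: "0 \<le> z" "z \<le> s"
    define w where "w = 1 - z * r"
    have w: "0 < w" "w \<le> 1" using sr[of z] z s r by (auto simp: w_def)
    have "((\<lambda>s. \<phi>' s - q' s) has_real_derivative (\<phi>'' z - r\<^sup>2 / w ^ 3)) (at z)"
      unfolding q'_def using z s w
      by (auto intro!: derivative_eq_intros d2 simp: w_def[symmetric])
         (simp add: field_simps power2_eq_square power3_eq_cube power4_eq_xxxx)
    moreover have "\<phi>'' z \<le> r\<^sup>2 / w\<^sup>2" using bd[of z] z s by (simp add: w_def power_divide)
    moreover have "r\<^sup>2 / w\<^sup>2 \<le> r\<^sup>2 / w ^ 3"
      using w by (intro divide_left_mono power_decreasing) auto
    ultimately show "\<exists>y. ((\<lambda>s. \<phi>' s - q' s) has_real_derivative y) (at z) \<and> y \<le> 0"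
      by (intro exI conjI) auto
  qed
  have d1': "\<phi>' s \<le> \<phi>' 0 + q' s" if "0 \<le> s" "s \<le> t" for s
    using q_mono[OF that] by (simp add: q'_def algebra_simps)
  have "\<phi> t - t * \<phi>' 0 - (t * r)\<^sup>2 / (2 * (1 - t * r)) \<le> \<phi> 0 - 0 * \<phi>' 0 - (0 * r)\<^sup>2 / (2 * (1 - 0 * r))"
  proof (rule DERIV_nonpos_imp_nonincreasing[OF t])
    fix z assume z: "0 \<le> z" "z \<le> t"
    define w where "w = 1 - z * r"
    have w: "0 < w" using sr[of z] z by (simp add: w_def)
    have zr: "z * r = 1 - w" by (simp add: w_def)
    have "((\<lambda>s. (s * r)\<^sup>2 / (2 * (1 - s * r))) has_real_derivative q' z) (at z)"
      unfolding q'_def using w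
      apply (auto intro!: derivative_eq_intros simp: w_def[symmetric] zr)
      apply (simp add: field_simps power2_eq_square)
      done
    note q = this
    have lin: "((\<lambda>s. \<phi> s - s * \<phi>' 0) has_real_derivative \<phi>' z - \<phi>' 0) (at z)"
      using z by (auto intro!: derivative_eq_intros d1)
    have "((\<lambda>s. \<phi> s - s * \<phi>' 0 - (s * r)\<^sup>2 / (2 * (1 - s * r))) has_real_derivative
        (\<phi>' z - \<phi>' 0 - q' z)) (at z)"
      using DERIV_diff[OF lin q] .
    then show "\<exists>y. ((\<lambda>s. \<phi> s - s * \<phi>' 0 - (s * r)\<^sup>2 / (2 * (1 - s * r))) has_real_derivative y) (at z) \<and> y \<le> 0"
      using d1'[OF z] by (intro exI conjI) auto
  qed
  then show ?thesis by simp
qed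

section \<open>Logarithmic estimates behind the final rate\<close>

lemma sum_inverse_le_ln:
  assumes "1 \<le> n"
  shows "(\<Sum>k<n. 1 / (real k + 1)) \<le> 1 + ln (real n)"
  using assms
proof (induction n rule: dec_induct)
  case (step n)
  \<comment> \<open>The inequality \<open>ln z \<le> z - 1\<close> at \<open>z = n / (n + 1)\<close>
    bounds the new term by \<open>ln (n + 1) - ln n\<close>, which telescopes.\<close>
  have "ln (real n / real (Suc n)) \<le> real n / real (Suc n) - 1"
    using step by (intro ln_le_minus_one) auto
  also have "\<dots> = - (1 / (real n + 1))" by (simp add: field_simps)
  finally have "1 / (real n + 1) \<le> ln (real (Suc n)) - ln (real n)"
    using step by (simp add: ln_div)
  then show ?case using step by simp
qed simp

text \<open>Turns a threshold of the form \<open>a * ln a\<close> into decay of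
  \<open>ln u / u\<close>; the absolute value appears because the threshold on the horizon is
  squared. Small \<open>a\<close> needs only \<open>exp 1 * ln u \<le> u\<close>; large
  \<open>a\<close> uses the tangent of \<open>ln\<close> at \<open>a * ln a\<close> together with
  \<open>ln (ln a) \<le> ln a - 1\<close>. Splitting at \<open>2 * exp 1\<close> yields the constant
  2 in the first case and \<open>1 < ln a\<close> in the second.\<close>

lemma mult_ln_le_of_ge:
  fixes a u :: real
  assumes u: "1 < u" and au: "\<bar>a * ln a\<bar> \<le> u" and a: "0 < a"
  shows "a * ln u \<le> 2 * u"
proof (cases "a \<le> 2 * exp 1")
  case True
  have "ln (u / exp 1) \<le> u / exp 1 - 1" using u by (intro ln_le_minus_one) auto
  then have "exp 1 * ln u \<le> u" using u by (simp add: ln_div field_simps)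
  moreover have "a * ln u \<le> (2 * exp 1) * ln u" using True u by (intro mult_right_mono) auto
  ultimately show ?thesis by linarith
next
  case False
  have e: "(2::real) \<le> exp 1" using exp_ge_add_one_self[of 1] by simp
  have la: "1 < ln a" using False a e by (subst ln_exp[of 1, symmetric], subst ln_less_cancel_iff) auto
  define v where "v = a * ln a"
  have v: "0 < v" "v \<le> u" using a au mult_pos_pos[OF a order.strict_trans[OF zero_less_one la]] by (auto simp: v_def)
  have "ln (u / v) \<le> u / v - 1" using u v by (intro ln_le_minus_one) auto
  then have "ln u \<le> ln v + u / v - 1" using u v by (simp add: ln_div)
  moreover have "ln v \<le> 2 * ln a - 1"
    using ln_le_minus_one[OF order.strict_trans[OF zero_less_one la]]
      ln_mult_pos[OF a order.strict_trans[OF zero_less_one la]] unfolding v_def by linarith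
  ultimately have "ln u \<le> 2 * ln a + u / v - 2" by linarith
  then have "a * ln u \<le> a * (2 * ln a + u / v - 2)" using a by (intro mult_left_mono) auto
  also have "\<dots> = 2 * v + u / ln a - 2 * a" using a la by (simp add: v_def field_simps)
  finally have *: "a * ln u \<le> 2 * v + u / ln a - 2 * a" .
  have "2 * v + u / ln a - 2 * a - 2 * u = (u - v) * (1 / ln a - 2) - a"
    using la by (simp add: v_def field_simps)
  \<comment> \<open>The factors have opposite signs: \<open>v \<le> u\<close>, and
    \<open>1 / ln a < 2\<close> because \<open>1 < ln a\<close>.\<close>
  moreover have "(u - v) * (1 / ln a - 2) \<le> 0"
    using v la by (intro mult_nonneg_nonpos) (auto simp: field_simps)
  ultimately show ?thesis using * a by linarith
qed

section \<open>Self-concordant barriers of pointed cones\<close>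

lemma continuous_on_det:
  fixes M :: "'a::topological_space \<Rightarrow> real^'n^'n"
  assumes "\<And>i j. continuous_on S (\<lambda>y. M y $ i $ j)"
  shows "continuous_on S (\<lambda>y. det (M y))"
  unfolding det_def by (intro continuous_intros assms)

text \<open>Column \<open>j\<close> of the inverse solves the linear system with right-hand side
  \<open>axis j 1\<close>, so by Cramer's rule its entries are quotients of determinants with
  nonzero denominator.\<close>

lemma continuous_on_matrix_inv:
  fixes M :: "'a::topological_space \<Rightarrow> real^'n^'n"
  assumes M: "continuous_on S M" and inv: "\<And>y. y \<in> S \<Longrightarrow> invertible (M y)"
  shows "continuous_on S (\<lambda>y. matrix_inv (M y))"
proof -
  have c: "continuous_on S (\<lambda>y. M y $ i $ j)" for i j
    by (intro continuous_intros M)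
  have eq: "matrix_inv (M y) =
      (\<chi> i j. det (\<chi> i' j'. if j' = i then axis j 1 $ i' else M y $ i' $ j') / det (M y))"
    if y: "y \<in> S" for y
  proof -
    have d: "det (M y) \<noteq> 0" using inv[OF y] by (simp add: invertible_det_nz)
    have "matrix_inv (M y) *v axis j 1
        = (\<chi> i. det (\<chi> i' j'. if j' = i then axis j 1 $ i' else M y $ i' $ j') / det (M y))" for j
      using matrix_inv_mult_vector(1)[OF inv[OF y], of "axis j 1"] by (simp only: cramer[OF d])
    then have "column j (matrix_inv (M y))
        = (\<chi> i. det (\<chi> i' j'. if j' = i then axis j 1 $ i' else M y $ i' $ j') / det (M y))" for j
      by (simp add: matrix_vector_mult_basis)
    then show ?thesis by (simp add: column_def vec_eq_iff)
  qed
  have "continuous_on S (\<lambda>y. \<chi> i j.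
      det (\<chi> i' j'. if j' = i then axis j 1 $ i' else M y $ i' $ j') / det (M y))"
  proof (intro continuous_on_vec_lambda continuous_on_divide continuous_on_det)
    fix i j i' j'
    show "continuous_on S (\<lambda>y. (\<chi> i' j'. if j' = i then axis j 1 $ i' else M y $ i' $ j') $ i' $ j')"
      using c by (cases "j' = i") (auto intro: continuous_intros)
  qed (use c inv in \<open>auto simp: invertible_det_nz\<close>)
  then show ?thesis using eq by (simp cong: continuous_on_cong)
qed

text \<open>Makes the definite description in \<open>grad\<close> meaningful: the adjoint of the
  derivative at 1 represents it, and uniqueness of derivatives leaves no other vector.\<close>

lemma has_derivative_grad:
  assumes "f differentiable (at x)"
  shows "(f has_derivative (\<lambda>h. grad f x \<bullet> h)) (at x)"
proof -
  obtain f' where f': "(f has_derivative f') (at x)" using assms by (auto simp: differentiable_def)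
  have eq: "f' = (\<lambda>h. h \<bullet> adjoint f' 1)"
    using adjoint_works[OF has_derivative_linear[OF f'], of _ 1] by simp
  then have ex: "GDERIV f x :> adjoint f' 1" using f' by (simp add: gderiv_def)
  have "GDERIV f x :> grad f x" unfolding grad_def
  proof (rule theI[of "\<lambda>g. GDERIV f x :> g", OF ex])
    fix g assume "GDERIV f x :> g"
    then have "(\<lambda>h. h \<bullet> g) = (\<lambda>h. h \<bullet> adjoint f' 1)"
      using ex unfolding gderiv_def by (rule has_derivative_unique)
    then show "g = adjoint f' 1" by (metis vector_eq_ldot)
  qed
  then show ?thesis by (simp add: gderiv_def inner_commute)
qed

lemma frechet_derivative_grad:
  "f differentiable (at x) \<Longrightarrow> frechet_derivative f (at x) h = grad f x \<bullet> h"
  using frechet_derivative_at[OF has_derivative_grad] by metis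

lemma grad_eqI:
  assumes "(f has_derivative (\<lambda>h. g \<bullet> h)) (at x)"
  shows "grad f x = g"
proof -
  have "(\<lambda>h. grad f x \<bullet> h) = (\<lambda>h. g \<bullet> h)"
    using has_derivative_unique[OF has_derivative_grad assms] assms by (auto simp: differentiable_def)
  then show ?thesis by (metis vector_eq_rdot)
qed

lemma continuous_on_grad:
  assumes "C_diff_on 1 f S"
  shows "continuous_on S (grad f)"
proof -
  have "continuous_on S (\<lambda>x. \<Sum>b\<in>Basis. frechet_derivative f (at x) b *\<^sub>R b)"
    using assms by (auto intro!: continuous_intros)
  moreover have "(\<Sum>b\<in>Basis. frechet_derivative f (at x) b *\<^sub>R b) = grad f x" if "x \<in> S" for x
    using assms that by (simp add: frechet_derivative_grad euclidean_representation)
  ultimately show ?thesis by (simp cong: continuous_on_cong)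
qed

lemma has_real_derivative_along_line:
  fixes g :: "'a::real_normed_vector \<Rightarrow> real"
  assumes "(g has_derivative g') (at (x + t *\<^sub>R u))"
  shows "((\<lambda>t. g (x + t *\<^sub>R u)) has_real_derivative g' u) (at t)"
proof -
  have "((\<lambda>t. x + t *\<^sub>R u) has_derivative (\<lambda>r. r *\<^sub>R u)) (at t)"
    by (auto intro!: derivative_eq_intros)
  from has_derivative_compose[OF this assms]
  have "((\<lambda>t. g (x + t *\<^sub>R u)) has_derivative (\<lambda>r. g' (r *\<^sub>R u))) (at t)" .
  then show ?thesis
    using linear_scale[OF has_derivative_linear[OF assms]]
    by (simp add: has_field_derivative_def mult.commute[of _ "g' u"])
qed

lemma eventually_line_in_open:
  fixes x u :: "'a::real_normed_vector"
  assumes "open U" "x + t *\<^sub>R u \<in> U"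
  shows "\<forall>\<^sub>F s in nhds t. x + s *\<^sub>R u \<in> U"
proof -
  have "isCont (\<lambda>s. x + s *\<^sub>R u) t" by (intro continuous_intros)
  then have "\<forall>\<^sub>F s in at t. x + s *\<^sub>R u \<in> U"
    using assms by (auto simp: isCont_def dest: topological_tendstoD)
  then show ?thesis using assms(2) by (auto simp: eventually_at_filter elim: eventually_mono)
qed

text \<open>Both norms of the method are \<open>quad_norm\<close>, for the Hessian and for its
  inverse, so each norm inequality is proved once for both.\<close>

lemma local_norm_quad: "local_norm B x = quad_norm (hess B x)"
  by (rule ext) (simp add: local_norm_def quad_norm_def)

lemma dual_norm_quad: "dual_norm B x = quad_norm (matrix_inv (hess B x))"
  by (rule ext) (simp add: dual_norm_def quad_norm_def)

locale cone_barrier =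
  fixes K :: "(real^'n) set" and \<theta> :: real and B :: "real^'n \<Rightarrow> real"
  assumes cone: "proper_cone K" and barrier: "LHSC_barrier K \<theta> B"
begin

abbreviation U :: "(real^'n) set" where "U \<equiv> interior K"

text \<open>The third derivative of \<open>B\<close> along \<open>u\<close> with a free base point;
  the barrier axiom speaks only of parameter 0 on a line, whereas the growth argument needs all
  points of a segment.\<close>

definition third :: "real^'n \<Rightarrow> real^'n \<Rightarrow> real" where
  "third y u = frechet_derivative (\<lambda>y. u \<bullet> (hess B y *v u)) (at y) u"

lemma B_differentiable: "y \<in> U \<Longrightarrow> B differentiable (at y)"
  using barrier by (simp add: LHSC_barrier_def numeral_3_eq_3)

text \<open>The smoothness predicate concerns Frechet derivatives in fixed directions. On the open
  set \<open>U\<close> these agree with inner products with the gradient, and differentiability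
  transfers.\<close>

lemma grad_B_inner_differentiable:
  assumes y: "y \<in> U" shows "(\<lambda>y. grad B y \<bullet> h) differentiable (at y)"
proof -
  have "(\<lambda>y. frechet_derivative B (at y) h) differentiable (at y)"
    using barrier y by (simp add: LHSC_barrier_def numeral_3_eq_3)
  then obtain D where "((\<lambda>y. frechet_derivative B (at y) h) has_derivative D) (at y)"
    by (auto simp: differentiable_def)
  from has_derivative_transform_within_open[OF this open_interior y]
  have "((\<lambda>y. grad B y \<bullet> h) has_derivative D) (at y)"
    by (simp add: frechet_derivative_grad B_differentiable)
  then show ?thesis by (auto simp: differentiable_def)
qed

lemma grad_B_has_derivative:
  assumes y: "y \<in> U" shows "(grad B has_derivative (\<lambda>h. hess B y *v h)) (at y)"
proof -
  have "(\<lambda>y. \<Sum>b\<in>Basis. (grad B y \<bullet> b) *\<^sub>R b) differentiable (at y)"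
    by (intro differentiable_sum differentiable_scaleR grad_B_inner_differentiable[OF y]
        differentiable_const finite_Basis ballI)
  then have "grad B differentiable (at y)" by (simp add: euclidean_representation)
  then show ?thesis unfolding hess_def by (simp add: jacobian_works)
qed

lemma grad_B_inner_has_derivative:
  assumes y: "y \<in> U"
  shows "((\<lambda>y. grad B y \<bullet> h) has_derivative (\<lambda>k. h \<bullet> (hess B y *v k))) (at y)"
  using has_derivative_inner_left[OF grad_B_has_derivative[OF y], of h] by (simp add: inner_commute)

lemma hess_bilinear_differentiable:
  assumes y: "y \<in> U" shows "(\<lambda>y. h \<bullet> (hess B y *v k)) differentiable (at y)"
proof -
  have "(\<lambda>y. frechet_derivative (\<lambda>y. frechet_derivative B (at y) h) (at y) k) differentiable (at y)"
    using barrier y by (simp add: LHSC_barrier_def numeral_3_eq_3)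
  then obtain D where "((\<lambda>y. frechet_derivative (\<lambda>y. frechet_derivative B (at y) h) (at y) k) has_derivative D) (at y)"
    by (auto simp: differentiable_def)
  moreover have "frechet_derivative (\<lambda>y. frechet_derivative B (at y) h) (at z) k = h \<bullet> (hess B z *v k)"
    if z: "z \<in> U" for z
  proof -
    have "((\<lambda>y. frechet_derivative B (at y) h) has_derivative (\<lambda>k. h \<bullet> (hess B z *v k))) (at z)"
      by (rule has_derivative_transform_within_open[OF grad_B_inner_has_derivative[OF z] open_interior z])
        (simp add: frechet_derivative_grad B_differentiable)
    from frechet_derivative_at[OF this] show ?thesis by metis
  qed
  ultimately have "((\<lambda>y. h \<bullet> (hess B y *v k)) has_derivative D) (at y)"
    by (rule has_derivative_transform_within_open[OF _ open_interior y])
  then show ?thesis by (auto simp: differentiable_def)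
qed

lemma hess_bilinear_isCont: "y \<in> U \<Longrightarrow> isCont (\<lambda>y. h \<bullet> (hess B y *v k)) y"
  by (intro differentiable_imp_continuous_within hess_bilinear_differentiable)

lemma hess_symmetric:
  assumes y: "y \<in> U" shows "h \<bullet> (hess B y *v k) = k \<bullet> (hess B y *v h)"
  by (rule second_derivative_symmetric[OF open_interior y has_derivative_grad[OF B_differentiable]
        grad_B_inner_has_derivative grad_B_inner_has_derivative
        hess_bilinear_isCont[OF y] hess_bilinear_isCont[OF y]])

lemma continuous_on_grad_B: "continuous_on U (grad B)"
  by (rule has_derivative_continuous_on[OF has_derivative_at_withinI[OF grad_B_has_derivative]])

lemma continuous_on_hess: "continuous_on U (hess B)"
proof -
  have "continuous_on U (\<lambda>y. hess B y $ i $ j)" for i j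
  proof -
    have "hess B y $ i $ j = axis i 1 \<bullet> (hess B y *v axis j 1)" for y
      by (simp add: inner_axis' matrix_vector_mult_basis column_def)
    then show ?thesis
      by (simp only:) (intro continuous_at_imp_continuous_on ballI hess_bilinear_isCont)
  qed
  then have "continuous_on U (\<lambda>y. \<chi> i j. hess B y $ i $ j)"
    by (intro continuous_on_vec_lambda)
  then show ?thesis by simp
qed

lemma line_derivs:
  assumes "x + t *\<^sub>R u \<in> U"
  shows "((\<lambda>t. B (x + t *\<^sub>R u)) has_real_derivative grad B (x + t *\<^sub>R u) \<bullet> u) (at t)"
    and "((\<lambda>t. grad B (x + t *\<^sub>R u) \<bullet> u) has_real_derivative u \<bullet> (hess B (x + t *\<^sub>R u) *v u)) (at t)"
    and "((\<lambda>t. u \<bullet> (hess B (x + t *\<^sub>R u) *v u)) has_real_derivative third (x + t *\<^sub>R u) u) (at t)"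
proof -
  show "((\<lambda>t. B (x + t *\<^sub>R u)) has_real_derivative grad B (x + t *\<^sub>R u) \<bullet> u) (at t)"
    by (rule has_real_derivative_along_line[OF has_derivative_grad[OF B_differentiable[OF assms]]])
  show "((\<lambda>t. grad B (x + t *\<^sub>R u) \<bullet> u) has_real_derivative u \<bullet> (hess B (x + t *\<^sub>R u) *v u)) (at t)"
    by (rule has_real_derivative_along_line[OF grad_B_inner_has_derivative[OF assms]])
  show "((\<lambda>t. u \<bullet> (hess B (x + t *\<^sub>R u) *v u)) has_real_derivative third (x + t *\<^sub>R u) u) (at t)"
    unfolding third_def
    by (rule has_real_derivative_along_line)
      (use hess_bilinear_differentiable[OF assms] frechet_derivative_works in blast)
qed

text \<open>The axiom is phrased with iterated \<open>deriv\<close>, and a formula for one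
  derivative can be differentiated again only if it holds in a neighbourhood. The formulas are
  therefore established eventually near 0.\<close>

lemma self_concordance:
  assumes x: "x \<in> U"
  shows "\<bar>third x u\<bar> \<le> 2 * (u \<bullet> (hess B x *v u)) powr (3/2)"
proof -
  define \<phi> where "\<phi> = (\<lambda>t. B (x + t *\<^sub>R u))"
  have ev: "\<forall>\<^sub>F t in nhds 0. x + t *\<^sub>R u \<in> U"
    using x by (intro eventually_line_in_open) auto
  have 1: "\<forall>\<^sub>F t in nhds 0. deriv \<phi> t = grad B (x + t *\<^sub>R u) \<bullet> u"
    using ev by eventually_elim (auto simp: \<phi>_def intro!: DERIV_imp_deriv line_derivs)
  \<comment> \<open>For \<open>s\<close> near 0 the formula also holds near \<open>s\<close>, as
    needed to differentiate at \<open>s\<close> rather than only at 0.\<close>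
  then have "\<forall>\<^sub>F s in nhds 0. \<forall>\<^sub>F t in nhds s. deriv \<phi> t = grad B (x + t *\<^sub>R u) \<bullet> u"
    by (simp add: eventually_eventually)
  with ev have 2: "\<forall>\<^sub>F t in nhds 0. deriv (deriv \<phi>) t = u \<bullet> (hess B (x + t *\<^sub>R u) *v u)"
  proof eventually_elim
    case (elim t)
    have "deriv (deriv \<phi>) t = deriv (\<lambda>t. grad B (x + t *\<^sub>R u) \<bullet> u) t"
      using elim(2) by (rule deriv_cong_ev) simp
    then show ?case using DERIV_imp_deriv[OF line_derivs(2)[OF elim(1)]] by simp
  qed
  have "deriv (deriv (deriv \<phi>)) 0 = deriv (\<lambda>t. u \<bullet> (hess B (x + t *\<^sub>R u) *v u)) 0"
    using 2 by (rule deriv_cong_ev) simp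
  also have "\<dots> = third x u"
    using DERIV_imp_deriv[OF line_derivs(3)[of x 0 u]] x by simp
  finally have 3: "(deriv ^^ 3) \<phi> 0 = third x u" by (simp add: numeral_3_eq_3)
  have "(deriv ^^ 2) \<phi> 0 = u \<bullet> (hess B x *v u)"
    using eventually_nhds_x_imp_x[OF 2] by (simp add: numeral_2_eq_2)
  then show ?thesis
    using barrier x 3 unfolding LHSC_barrier_def Let_def \<phi>_def by metis
qed

lemma hess_nonneg:
  assumes x: "x \<in> U" shows "0 \<le> u \<bullet> (hess B x *v u)"
proof -
  have conv: "convex_on U B" using barrier by (simp add: LHSC_barrier_def)
  have "\<forall>\<^sub>F t in nhds 0. x + t *\<^sub>R u \<in> U"
    using x by (intro eventually_line_in_open) auto
  then obtain e where e: "0 < e" "\<And>t. dist t 0 < e \<Longrightarrow> x + t *\<^sub>R u \<in> U"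
    unfolding eventually_nhds_metric by blast
  have inU: "x + t *\<^sub>R u \<in> U" if "- e < t" "t < e" for t using e(2)[of t] that by auto
  have "convex_on {-e<..<e} (\<lambda>t. B (x + t *\<^sub>R u))"
  proof (rule convex_onI)
    fix t a b :: real assume t: "0 < t" "t < 1" and ab: "a \<in> {-e<..<e}" "b \<in> {-e<..<e}"
    have "B ((1 - t) *\<^sub>R (x + a *\<^sub>R u) + t *\<^sub>R (x + b *\<^sub>R u))
        \<le> (1 - t) * B (x + a *\<^sub>R u) + t * B (x + b *\<^sub>R u)"
      using conv t ab inU by (intro convex_onD) auto
    moreover have "(1 - t) *\<^sub>R (x + a *\<^sub>R u) + t *\<^sub>R (x + b *\<^sub>R u) = x + ((1 - t) *\<^sub>R a + t *\<^sub>R b) *\<^sub>R u"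
      by (simp add: algebra_simps)
    ultimately show "B (x + ((1 - t) *\<^sub>R a + t *\<^sub>R b) *\<^sub>R u) \<le> (1 - t) * B (x + a *\<^sub>R u) + t * B (x + b *\<^sub>R u)"
      by simp
  qed simp
  from convex_on_second_deriv_nonneg[OF this, of 0 "\<lambda>t. grad B (x + t *\<^sub>R u) \<bullet> u" "u \<bullet> (hess B x *v u)"]
  show ?thesis using e(1) x inU line_derivs(1) line_derivs(2)[of x 0 u] by auto
qed

text \<open>With \<open>r\<close> the local norm of \<open>u\<close>, self-concordance bounds the
  second derivative along the line by \<open>(r / (1 - s * r))\<^sup>2\<close>, which is then
  integrated twice. That the segment lies in \<open>U\<close> is a hypothesis because the bound is
  itself used, up to the exit time, to prove this.\<close>

lemma upper_bound_on_segment: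
  assumes t: "0 \<le> t" and small: "t * local_norm B x u < 1"
    and inU: "\<And>s. 0 \<le> s \<Longrightarrow> s \<le> t \<Longrightarrow> x + s *\<^sub>R u \<in> U"
  shows "B (x + t *\<^sub>R u) \<le> B x + t * (grad B x \<bullet> u)
    + (t * local_norm B x u)\<^sup>2 / (2 * (1 - t * local_norm B x u))"
proof -
  define r where "r = local_norm B x u"
  have x: "x \<in> U" using inU[of 0] t by simp
  have r: "0 \<le> r" using hess_nonneg[OF x] by (simp add: r_def local_norm_def)
  have "u \<bullet> (hess B (x + s *\<^sub>R u) *v u) \<le> (r / (1 - s * r))\<^sup>2" if s: "0 \<le> s" "s \<le> t" for s
  proof -
    have sr: "s * r < 1" using mult_right_mono[OF s(2) r] small by (simp add: r_def)
    have "sqrt (u \<bullet> (hess B (x + s *\<^sub>R u) *v u)) \<le> sqrt (u \<bullet> (hess B (x + 0 *\<^sub>R u) *v u))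
        / (1 - s * sqrt (u \<bullet> (hess B (x + 0 *\<^sub>R u) *v u)))"
      using sr s inU
      by (intro self_concordant_growth[where g = "\<lambda>s. u \<bullet> (hess B (x + s *\<^sub>R u) *v u)"
            and g' = "\<lambda>s. third (x + s *\<^sub>R u) u"])
        (auto simp: r_def local_norm_def intro!: hess_nonneg line_derivs self_concordance)
    then have "sqrt (u \<bullet> (hess B (x + s *\<^sub>R u) *v u)) \<le> r / (1 - s * r)"
      by (simp add: r_def local_norm_def)
    from sqrt_le_D[OF this] show ?thesis .
  qed
  from quadratic_upper_bound[OF t r _ _ _ this, of "\<lambda>t. B (x + t *\<^sub>R u)" "\<lambda>t. grad B (x + t *\<^sub>R u) \<bullet> u"]
  show ?thesis using small inU line_derivs by (simp add: r_def)
qed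

text \<open>For \<open>r = 0\<close> this yields a whole ray, for \<open>t = 1\<close> the Dikin ellipsoid: up to the
  first exit time \<open>B\<close> would stay bounded along the segment, contradicting its blow-up at the
  boundary.\<close>
lemma segment_in_interior:
  assumes x: "x \<in> U" and t: "0 \<le> t" and small: "t * local_norm B x u < 1"
  shows "x + t *\<^sub>R u \<in> U"
proof (rule ccontr)
  assume "x + t *\<^sub>R u \<notin> U"
  define r where "r = local_norm B x u"
  have r: "0 \<le> r" using hess_nonneg[OF x] by (simp add: r_def local_norm_def)
  define S where "S = {0..t} \<inter> (\<lambda>s. x + s *\<^sub>R u) -` (- U)"
  have "closed S" unfolding S_def
    by (intro closed_Int closed_atLeastAtMost continuous_closed_vimage) (auto intro!: continuous_intros)
  then have "compact S" by (metis S_def bounded_Int bounded_closed_interval compact_eq_bounded_closed)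
  moreover have "S \<noteq> {}" using \<open>x + t *\<^sub>R u \<notin> U\<close> t by (auto simp: S_def)
  ultimately obtain T where T: "T \<in> S" "\<And>s. s \<in> S \<Longrightarrow> T \<le> s" using compact_attains_inf[of S] by metis
  have T0: "0 < T" using T(1) x by (cases "T = 0") (auto simp: S_def)
  have Tt: "T \<le> t" using T(1) by (auto simp: S_def)
  have before: "x + s *\<^sub>R u \<in> U" if "0 \<le> s" "s < T" for s
    using T(2)[of s] that Tt by (auto simp: S_def)
  have Tr: "T * r < 1" using mult_right_mono[OF Tt r] small by (simp add: r_def)
  define z where "z = x + T *\<^sub>R u"
  have ev: "\<forall>\<^sub>F s in at_left T. 0 < s \<and> s < T"
    using eventually_at_left_field T0 by blast
  have lim: "((\<lambda>s. x + s *\<^sub>R u) \<longlongrightarrow> z) (at_left T)"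
    unfolding z_def by (intro tendsto_intros)
  \<comment> \<open>Needed for a punctured limit: the points of the segment before \<open>T\<close>
    must differ from \<open>z\<close>.\<close>
  have "u \<noteq> 0" using T(1) x by (auto simp: S_def)
  have fl: "filterlim (\<lambda>s. x + s *\<^sub>R u) (at z within U) (at_left T)"
    unfolding filterlim_at
  proof (intro conjI lim)
    show "\<forall>\<^sub>F s in at_left T. x + s *\<^sub>R u \<in> U \<and> x + s *\<^sub>R u \<noteq> z"
      using ev by eventually_elim (use before \<open>u \<noteq> 0\<close> in \<open>auto simp: z_def\<close>)
  qed
  have "z \<in> K"
  proof (rule Lim_in_closed_set[OF _ _ _ lim])
    show "closed K" using cone by (simp add: proper_cone_def)
    show "\<forall>\<^sub>F s in at_left T. x + s *\<^sub>R u \<in> K"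
      using ev by eventually_elim (use before interior_subset in force)
  qed simp
  moreover have "z \<notin> U" using T(1) by (simp add: S_def z_def)
  ultimately have "z \<in> frontier K" using closure_subset by (auto simp: frontier_def)
  then have "filterlim B at_top (at z within U)" using barrier by (simp add: LHSC_barrier_def)
  from filterlim_compose[OF this fl] have top: "filterlim (\<lambda>s. B (x + s *\<^sub>R u)) at_top (at_left T)" .
  \<comment> \<open>A bound uniform in \<open>s < T\<close>; the slope enters by its absolute value
    because its sign is unknown.\<close>
  define C where "C = B x + T * \<bar>grad B x \<bullet> u\<bar> + (T * r)\<^sup>2 / (2 * (1 - T * r))"
  have "B (x + s *\<^sub>R u) \<le> C" if s: "0 < s" "s < T" for s
  proof -
    have sr: "s * r \<le> T * r" using s r by (intro mult_right_mono) auto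
    have "B (x + s *\<^sub>R u) \<le> B x + s * (grad B x \<bullet> u) + (s * r)\<^sup>2 / (2 * (1 - s * r))"
      using sr Tr s before unfolding r_def by (intro upper_bound_on_segment) (simp_all add: less_imp_le)
    moreover have "s * (grad B x \<bullet> u) \<le> T * \<bar>grad B x \<bullet> u\<bar>"
      using s mult_left_mono[OF abs_ge_self, of s "grad B x \<bullet> u"]
        mult_right_mono[of s T "\<bar>grad B x \<bullet> u\<bar>"] by linarith
    moreover have "(s * r)\<^sup>2 / (2 * (1 - s * r)) \<le> (T * r)\<^sup>2 / (2 * (1 - T * r))"
    proof (rule frac_le)
      show "(s * r)\<^sup>2 \<le> (T * r)\<^sup>2" using sr s r by (intro power_mono) simp_all
    qed (use sr Tr in simp_all)
    ultimately show ?thesis unfolding C_def by linarith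
  qed
  then have "\<forall>\<^sub>F s in at_left T. B (x + s *\<^sub>R u) \<le> C"
    by (intro eventually_mono[OF ev]) blast
  moreover have "\<forall>\<^sub>F s in at_left T. C < B (x + s *\<^sub>R u)"
    using top by (simp add: filterlim_at_top_dense)
  ultimately have "\<forall>\<^sub>F s in at_left T. False" by eventually_elim linarith
  then show False by simp
qed

lemma hess_sym_pd:
  assumes x: "x \<in> U" shows "sym_pd (hess B x)"
  unfolding sym_pd_def
proof safe
  show "transpose (hess B x) = hess B x"
  proof (subst matrix_eq, rule allI)
    fix v
    have "w \<bullet> (transpose (hess B x) *v v) = w \<bullet> (hess B x *v v)" for w
      by (metis hess_symmetric[OF x] inner_commute inner_matrix_transpose)
    then show "transpose (hess B x) *v v = hess B x *v v"
      using vector_eq_ldot by blast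
  qed
  fix v :: "real^'n" assume v: "v \<noteq> 0"
  show "0 < v \<bullet> (hess B x *v v)"
  proof (rule ccontr)
    assume "\<not> 0 < v \<bullet> (hess B x *v v)"
    then have 0: "v \<bullet> (hess B x *v v) = 0" using hess_nonneg[OF x, of v] by linarith
    have direction: "w \<in> K" if w: "w \<bullet> (hess B x *v w) = 0" for w
    proof (rule Lim_in_closed_set)
      show "closed K" using cone by (simp add: proper_cone_def)
      \<comment> \<open>In a degenerate direction the whole ray from \<open>x\<close> lies in the
        cone. Scaling its points down keeps them in the cone, and the limit is the direction itself.
        Applied to \<open>v\<close> and \<open>- v\<close>, this contradicts pointedness.\<close>
      have "((\<lambda>n. inverse (real (Suc n)) *\<^sub>R x + w) \<longlonglongrightarrow> 0 *\<^sub>R x + w)"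
        by (intro tendsto_intros LIMSEQ_inverse_real_of_nat)
      then show "((\<lambda>n. inverse (real (Suc n)) *\<^sub>R x + w) \<longlonglongrightarrow> w)" by simp
      have "inverse (real (Suc n)) *\<^sub>R x + w \<in> K" for n
      proof -
        have "x + real (Suc n) *\<^sub>R w \<in> K"
          using segment_in_interior[OF x, of "real (Suc n)" w] w interior_subset[of K]
          by (auto simp: local_norm_def)
        then have "inverse (real (Suc n)) *\<^sub>R (x + real (Suc n) *\<^sub>R w) \<in> K"
          using cone by (intro mem_cone) (auto simp: proper_cone_def)
        then show ?thesis by (simp add: scaleR_add_right)
      qed
      then show "\<forall>\<^sub>F n in sequentially. inverse (real (Suc n)) *\<^sub>R x + w \<in> K" by simp
    qed simp
    have "(- v) \<bullet> (hess B x *v (- v)) = 0"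
      using 0 by (simp add: linear_neg[OF matrix_vector_mul_linear])
    then have "v \<in> K" "- v \<in> K" using direction 0 by blast+
    then show False using cone v by (auto simp: proper_cone_def)
  qed
qed

lemma continuous_on_inv_hess: "continuous_on U (\<lambda>y. matrix_inv (hess B y))"
  by (intro continuous_on_matrix_inv continuous_on_hess sym_pd_invertible hess_sym_pd)

end

section \<open>Descent along one step\<close>

text \<open>This and the following definitions express one iteration as functions of the current
  point \<open>y\<close> and the estimate \<open>g\<close>, so that the same terms serve the
  pathwise inequalities and the measurability proofs.\<close>

definition momentum :: "(real^'n \<Rightarrow> real) \<Rightarrow> real \<Rightarrow> real^'n \<Rightarrow> real^'n \<Rightarrow> real^'n" where
  "momentum B t y g = g + t *\<^sub>R (g + grad B y)"

definition multiplier :: "(real^'n \<Rightarrow> real) \<Rightarrow> real^'n^'m \<Rightarrow> real \<Rightarrow> real^'n \<Rightarrow> real^'n \<Rightarrow> real^'m" where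
  "multiplier B A t y g =
     - (matrix_inv (A ** matrix_inv (hess B y) ** transpose A) *v
        (A *v (matrix_inv (hess B y) *v momentum B t y g)))"

definition direction :: "(real^'n \<Rightarrow> real) \<Rightarrow> real^'n^'m \<Rightarrow> real \<Rightarrow> real^'n \<Rightarrow> real^'n \<Rightarrow> real^'n" where
  "direction B A t y g = momentum B t y g + transpose A *v multiplier B A t y g"

definition SIPM_step ::
    "(real^'n \<Rightarrow> real) \<Rightarrow> real^'n^'m \<Rightarrow> real \<Rightarrow> real \<Rightarrow> real^'n \<Rightarrow> real^'n \<Rightarrow> real^'n" where
  "SIPM_step B A e t y g =
     y - e *\<^sub>R ((1 / dual_norm B y (direction B A t y g)) *\<^sub>R
                (matrix_inv (hess B y) *v direction B A t y g))"

text \<open>A mixed quantity: the gradient is exact, but the multiplier is the one computed from the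
  estimate \<open>g\<close>, as in the residual of the theorem.\<close>

definition stationarity ::
    "(real^'n \<Rightarrow> real) \<Rightarrow> (real^'n \<Rightarrow> real) \<Rightarrow> real^'n^'m \<Rightarrow> real \<Rightarrow> real^'n \<Rightarrow> real^'n \<Rightarrow> real" where
  "stationarity f B A t y g =
     dual_norm B y (grad (barrier_fun f B t) y + transpose A *v multiplier B A t y g)"

lemma SIPM_run_iff:
  "SIPM_run A B \<eta> \<mu> x0 g m lam x \<longleftrightarrow>
    x 0 = x0 \<and> (\<forall>k. m k = momentum B (\<mu> k) (x k) (g k) \<and>
      lam k = multiplier B A (\<mu> k) (x k) (g k) \<and>
      x (Suc k) = SIPM_step B A (\<eta> k) (\<mu> k) (x k) (g k))"
  unfolding SIPM_run_def SIPM_step_def direction_def multiplier_def momentum_def Let_def by metis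

locale conic_problem = cone_barrier K \<theta> B
  for K :: "(real^'n) set" and \<theta> :: real and B :: "real^'n \<Rightarrow> real" +
  fixes A :: "real^'n^'m" and b :: "real^'m" and f :: "real^'n \<Rightarrow> real" and \<phi>low L s :: real
  assumes full_row_rank: "rank A = CARD('m)"
    and f_C1: "C_diff_on 1 f (feasible K A b)"
    and s: "0 < s" "s < 1"
    and L_nonneg: "0 \<le> L"
    and lower_bound: "\<And>y t. y \<in> strictly_feasible K A b \<Longrightarrow> 0 < t \<Longrightarrow> t \<le> 1 \<Longrightarrow>
        \<phi>low \<le> f y + t * B y"
    and Lipschitz: "\<And>y z. y \<in> strictly_feasible K A b \<Longrightarrow> z \<in> strictly_feasible K A b \<Longrightarrow>
        local_norm B y (z - y) \<le> s \<Longrightarrow>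
        dual_norm B y (grad f z - grad f y) \<le> L * local_norm B y (z - y)"
begin

abbreviation F :: "(real^'n) set" where "F \<equiv> strictly_feasible K A b"

definition L\<phi> :: real where "L\<phi> = 2 * L + 1 / (1 - s)"

lemma F_interior: "y \<in> F \<Longrightarrow> y \<in> interior K"
  by (simp add: strictly_feasible_def)

lemma F_sym_pd: "y \<in> F \<Longrightarrow> sym_pd (hess B y)"
  by (rule hess_sym_pd[OF F_interior])

lemma f_differentiable:
  assumes "y \<in> F" shows "f differentiable (at y)"
proof -
  have "y \<in> feasible K A b"
    using assms interior_subset[of K] by (auto simp: feasible_def strictly_feasible_def)
  then show ?thesis using f_C1 by simp
qed

lemma grad_barrier_fun:
  assumes "y \<in> F"
  shows "grad (barrier_fun f B t) y = (1 + t) *\<^sub>R grad f y + t *\<^sub>R grad B y"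
  unfolding barrier_fun_def
  by (rule grad_eqI)
    (auto intro!: derivative_eq_intros has_derivative_grad f_differentiable[OF assms]
        B_differentiable[OF F_interior[OF assms]] simp: algebra_simps inner_add_left)

lemma F_step:
  assumes y: "y \<in> F" and p: "A *v p = 0" and t: "0 \<le> t" "t * local_norm B y p < 1"
  shows "y + t *\<^sub>R p \<in> F"
  using segment_in_interior[OF F_interior[OF y] t] y p
  by (simp add: strictly_feasible_def matrix_vector_right_distrib matrix_vector_mult_scaleR)

lemma local_norm_nonneg: "y \<in> F \<Longrightarrow> 0 \<le> local_norm B y p"
  by (simp add: local_norm_quad quad_norm_nonneg F_sym_pd)

lemma dual_norm_nonneg: "y \<in> F \<Longrightarrow> 0 \<le> dual_norm B y v"
  by (simp add: dual_norm_quad quad_norm_nonneg sym_pd_matrix_inv F_sym_pd)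

text \<open>The classical descent lemma with the norm frozen at \<open>y\<close>: the Lipschitz
  condition compares every gradient on the segment with the one at \<open>y\<close> in the dual norm
  of \<open>y\<close>.\<close>

lemma f_upper_bound:
  assumes y: "y \<in> F" and p: "A *v p = 0" and r: "local_norm B y p \<le> s"
  shows "f (y + p) \<le> f y + grad f y \<bullet> p + L / 2 * (local_norm B y p)\<^sup>2"
proof -
  define r where "r = local_norm B y p"
  have r0: "0 \<le> r" using local_norm_nonneg[OF y] by (simp add: r_def)
  have tr: "t * r \<le> r" if "t \<le> 1" for t
    using mult_right_mono[OF that r0] by simp
  have inF: "y + t *\<^sub>R p \<in> F" if "0 \<le> t" "t \<le> 1" for t
    using tr[OF that(2)] r s that(1) by (intro F_step y p) (auto simp: r_def)
  define q where "q t = f (y + t *\<^sub>R p) - t * (grad f y \<bullet> p) - L / 2 * (t * r)\<^sup>2" for t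
  have "q 1 \<le> q 0"
  proof (rule DERIV_nonpos_imp_nonincreasing[where f = q])
    fix t :: real assume t: "0 \<le> t" "t \<le> 1"
    have d: "((\<lambda>t. f (y + t *\<^sub>R p)) has_real_derivative grad f (y + t *\<^sub>R p) \<bullet> p) (at t)"
      by (rule has_real_derivative_along_line[OF has_derivative_grad[OF f_differentiable[OF inF[OF t]]]])
    have "(q has_real_derivative
        (grad f (y + t *\<^sub>R p) - grad f y) \<bullet> p - L * (t * r) * r) (at t)"
      unfolding q_def by (auto intro!: derivative_eq_intros d simp: inner_diff_left)
    moreover have "(grad f (y + t *\<^sub>R p) - grad f y) \<bullet> p \<le> L * (t * r) * r"
    proof -
      have lt: "local_norm B y (t *\<^sub>R p) = t * r"
        using t by (simp add: local_norm_quad quad_norm_scaleR r_def)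
      have "\<bar>(grad f (y + t *\<^sub>R p) - grad f y) \<bullet> p\<bar> \<le> dual_norm B y (grad f (y + t *\<^sub>R p) - grad f y) * r"
        unfolding dual_norm_quad local_norm_quad r_def by (rule quad_dual_pairing[OF F_sym_pd[OF y]])
      also have "\<dots> \<le> L * (t * r) * r"
        using Lipschitz[OF y inF[OF t]] lt tr[OF t(2)] r r0 by (intro mult_right_mono) (auto simp: r_def)
      finally show ?thesis by linarith
    qed
    ultimately show "\<exists>d. (q has_real_derivative d) (at t) \<and> d \<le> 0"
      by (intro exI conjI) auto
  qed simp
  then show ?thesis by (simp add: q_def r_def)
qed

text \<open>Origin of \<open>L\<phi>\<close>: the bound for \<open>f\<close> is multiplied by
  \<open>1 + t \<le> 2\<close> and that for \<open>B\<close> by \<open>t \<le> 1\<close>, while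
  \<open>1 / (1 - r) \<le> 1 / (1 - s)\<close> for local step length \<open>r\<close>.\<close>

lemma barrier_fun_upper_bound:
  assumes y: "y \<in> F" and p: "A *v p = 0" and r: "local_norm B y p \<le> s" and t: "0 < t" "t \<le> 1"
  shows "barrier_fun f B t (y + p)
    \<le> barrier_fun f B t y + grad (barrier_fun f B t) y \<bullet> p + L\<phi> / 2 * (local_norm B y p)\<^sup>2"
proof -
  define r where "r = local_norm B y p"
  have r0: "0 \<le> r" using local_norm_nonneg[OF y] by (simp add: r_def)
  have "B (y + 1 *\<^sub>R p) \<le> B y + 1 * (grad B y \<bullet> p) + (1 * r)\<^sup>2 / (2 * (1 - 1 * r))"
    unfolding r_def
  proof (rule upper_bound_on_segment)
    fix q :: real assume q: "0 \<le> q" "q \<le> 1"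
    have "q * local_norm B y p < 1"
      using mult_right_mono[OF q(2) r0] r s by (simp add: r_def)
    then show "y + q *\<^sub>R p \<in> interior K" by (intro segment_in_interior F_interior y q)
  qed (use r s in auto)
  also have "(1 * r)\<^sup>2 / (2 * (1 - 1 * r)) \<le> r\<^sup>2 / (2 * (1 - s))"
    using r s r0 by (intro frac_le) (auto simp: r_def)
  finally have Bb: "B (y + p) \<le> B y + grad B y \<bullet> p + r\<^sup>2 / (2 * (1 - s))" by simp
  define P C where "P = L / 2 * r\<^sup>2" and "C = r\<^sup>2 / (2 * (1 - s))"
  have fb: "f (y + p) \<le> f y + grad f y \<bullet> p + P"
    unfolding P_def r_def by (rule f_upper_bound[OF y p r])
  have "(1 + t) * P \<le> 2 * P"
    using t L_nonneg by (intro mult_right_mono) (auto simp: P_def)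
  moreover have "t * C \<le> 1 * C"
    using t s by (intro mult_right_mono) (auto simp: C_def)
  moreover have eq: "L\<phi> / 2 * r\<^sup>2 = 2 * P + C"
    using s by (simp add: L\<phi>_def P_def C_def field_simps)
  moreover have "(1 + t) * f (y + p) \<le> (1 + t) * (f y + grad f y \<bullet> p + P)"
    using fb t by (intro mult_left_mono) auto
  moreover have "t * B (y + p) \<le> t * (B y + grad B y \<bullet> p + C)"
    using Bb t unfolding C_def by (intro mult_left_mono) auto
  ultimately show ?thesis
    unfolding grad_barrier_fun[OF y] barrier_fun_def r_def[symmetric] eq
    by (simp add: algebra_simps inner_add_left)
qed

text \<open>The multiplier solves the normal equations, which cancel the image of the momentum.
  Hence steps preserve the equality constraints.\<close>

lemma direction_conjugate:
  assumes y: "y \<in> F"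
  shows "A *v (matrix_inv (hess B y) *v direction B A t y g) = 0"
proof -
  let ?H = "matrix_inv (hess B y)"
  let ?N = "A ** ?H ** transpose A"
  have inv: "invertible ?N"
    by (rule normal_matrix_invertible[OF full_row_rank sym_pd_matrix_inv[OF F_sym_pd[OF y]]])
  have "A *v (?H *v (transpose A *v multiplier B A t y g)) = ?N *v multiplier B A t y g"
    by (simp add: matrix_vector_mul_assoc matrix_mul_assoc del: transpose_matrix_vector)
  also have "\<dots> = - (A *v (?H *v momentum B t y g))"
    unfolding multiplier_def
    by (simp only: linear_neg[OF matrix_vector_mul_linear] matrix_inv_mult_vector[OF inv])
  finally show ?thesis
    unfolding direction_def by (simp only: matrix_vector_right_distrib) simp
qed

text \<open>If the direction is \<open>0\<close>, the junk value \<open>1 / 0 = 0\<close> makes the displacement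
  vanish and all three facts persist.\<close>
lemma SIPM_step_displacement:
  fixes e t :: real and y g :: "real^'n"
  assumes y: "y \<in> F" and e: "0 \<le> e"
  defines "p \<equiv> SIPM_step B A e t y g - y"
  shows "A *v p = 0" "local_norm B y p \<le> e"
    "momentum B t y g \<bullet> p = - e * dual_norm B y (direction B A t y g)"
proof -
  let ?H = "matrix_inv (hess B y)"
  define d where "d = direction B A t y g"
  define \<delta> where "\<delta> = dual_norm B y d"
  have \<delta>: "0 \<le> \<delta>" using dual_norm_nonneg[OF y] by (simp add: \<delta>_def)
  have p: "p = (- (e / \<delta>)) *\<^sub>R (?H *v d)"
    by (simp add: p_def SIPM_step_def d_def \<delta>_def)
  show Ap: "A *v p = 0"
    unfolding p d_def matrix_vector_mult_scaleR direction_conjugate[OF y] by simp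
  show "local_norm B y p \<le> e"
    unfolding local_norm_quad p quad_norm_scaleR quad_norm_inverse_image[OF F_sym_pd[OF y]]
    using e \<delta> by (cases "\<delta> = 0") (auto simp: \<delta>_def dual_norm_quad)
  have dd: "d \<bullet> (?H *v d) = \<delta>\<^sup>2"
    by (simp add: \<delta>_def dual_norm_quad quad_norm_square sym_pd_matrix_inv F_sym_pd[OF y])
  have "d \<bullet> p = - (e / \<delta>) * \<delta>\<^sup>2" by (simp add: p dd)
  also have "\<dots> = - e * \<delta>" by (simp add: power2_eq_square)
  finally have "d \<bullet> p = - e * \<delta>" .
  moreover have "(transpose A *v multiplier B A t y g) \<bullet> p = 0"
    using Ap by (metis inner_matrix_transpose inner_zero_right)
  ultimately show "momentum B t y g \<bullet> p = - e * dual_norm B y (direction B A t y g)"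
    by (simp add: d_def \<delta>_def direction_def inner_add_left del: transpose_matrix_vector)
qed

lemma SIPM_step_in_F:
  assumes y: "y \<in> F" and e: "0 \<le> e" "e \<le> s"
  shows "SIPM_step B A e t y g \<in> F"
  using F_step[OF y SIPM_step_displacement(1)[OF y e(1)], of 1 t g]
    SIPM_step_displacement(2)[OF y e(1), of t g] e s by simp

text \<open>The factor 4 is 2 times 2. The exact gradient differs from the momentum by
  \<open>- (1 + t)\<close> times the estimation error, at most \<open>2 * \<epsilon>\<close> in dual
  norm. This enters once in the linear term and once when the norm of the direction is replaced by
  the stationarity residual.\<close>

lemma descent:
  assumes y: "y \<in> F" and e: "0 \<le> e" "e \<le> s" and t: "0 < t" "t \<le> 1"
  shows "barrier_fun f B t (SIPM_step B A e t y g) \<le> barrier_fun f B t y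
    - e * stationarity f B A t y g + 4 * (e * dual_norm B y (g - grad f y)) + L\<phi> / 2 * e\<^sup>2"
proof -
  define p where "p = SIPM_step B A e t y g - y"
  define d where "d = direction B A t y g"
  define w where "w = grad (barrier_fun f B t) y - momentum B t y g"
  define \<epsilon> where "\<epsilon> = dual_norm B y (g - grad f y)"
  note P = SIPM_step_displacement[OF y e(1), of t g, folded p_def d_def]
  have H: "sym_pd (matrix_inv (hess B y))" by (rule sym_pd_matrix_inv[OF F_sym_pd[OF y]])
  have \<epsilon>: "0 \<le> \<epsilon>" using dual_norm_nonneg[OF y] by (simp add: \<epsilon>_def)
  have "w = (- (1 + t)) *\<^sub>R (g - grad f y)"
    by (simp add: w_def grad_barrier_fun[OF y] momentum_def algebra_simps)
  then have "dual_norm B y w = (1 + t) * \<epsilon>"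
    using t by (simp only: dual_norm_quad quad_norm_scaleR \<epsilon>_def)
  also have "\<dots> \<le> 2 * \<epsilon>" using t \<epsilon> by (intro mult_right_mono) auto
  finally have w: "dual_norm B y w \<le> 2 * \<epsilon>" .
  have "stationarity f B A t y g = dual_norm B y (w + d)"
    by (simp add: stationarity_def w_def d_def direction_def)
  also have "\<dots> \<le> dual_norm B y w + dual_norm B y d"
    unfolding dual_norm_quad by (rule quad_norm_triangle[OF H])
  finally have st: "stationarity f B A t y g \<le> 2 * \<epsilon> + dual_norm B y d" using w by linarith
  have lp: "0 \<le> local_norm B y p" by (rule local_norm_nonneg[OF y])
  have "w \<bullet> p \<le> \<bar>w \<bullet> p\<bar>" by simp
  also have "\<dots> \<le> dual_norm B y w * local_norm B y p"
    unfolding dual_norm_quad local_norm_quad by (rule quad_dual_pairing[OF F_sym_pd[OF y]])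
  also have "\<dots> \<le> (2 * \<epsilon>) * e"
    using w P(2) lp \<epsilon> by (intro mult_mono) auto
  finally have wp: "w \<bullet> p \<le> 2 * (e * \<epsilon>)" by (simp add: mult_ac)
  have "grad (barrier_fun f B t) y \<bullet> p = w \<bullet> p + momentum B t y g \<bullet> p"
    by (simp add: w_def inner_diff_left)
  also have "\<dots> \<le> 2 * (e * \<epsilon>) - e * dual_norm B y d" using wp P(3) by simp
  finally have "grad (barrier_fun f B t) y \<bullet> p \<le> 2 * (e * \<epsilon>) - e * dual_norm B y d" .
  moreover have "e * (stationarity f B A t y g - 2 * \<epsilon>) \<le> e * dual_norm B y d"
    using st e by (intro mult_left_mono) auto
  ultimately have gp: "grad (barrier_fun f B t) y \<bullet> p \<le> 4 * (e * \<epsilon>) - e * stationarity f B A t y g"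
    by (simp add: algebra_simps)
  have "0 \<le> L\<phi>" using L_nonneg s by (simp add: L\<phi>_def)
  then have "L\<phi> / 2 * (local_norm B y p)\<^sup>2 \<le> L\<phi> / 2 * e\<^sup>2"
    using P(2) lp by (intro mult_left_mono power_mono) auto
  moreover have "barrier_fun f B t (y + p) \<le> barrier_fun f B t y
      + grad (barrier_fun f B t) y \<bullet> p + L\<phi> / 2 * (local_norm B y p)\<^sup>2"
    using P e t by (intro barrier_fun_upper_bound y) auto
  ultimately show ?thesis using gp by (simp add: p_def \<epsilon>_def)
qed

text \<open>Factoring out \<open>1 + t\<close> leaves \<open>f + t / (1 + t) * B\<close>, whose
  parameter again lies in the admissible range.\<close>

lemma barrier_fun_lower_bound:
  assumes y: "y \<in> F" and t: "0 < t" "t \<le> 1"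
  shows "(1 + t) * min \<phi>low 0 \<le> barrier_fun f B t y"
proof -
  have "\<phi>low \<le> f y + t / (1 + t) * B y"
    using t by (intro lower_bound y) (auto simp: field_simps)
  then have "(1 + t) * min \<phi>low 0 \<le> (1 + t) * (f y + t / (1 + t) * B y)"
    using t by (intro mult_left_mono) auto
  also have "\<dots> = barrier_fun f B t y" using t by (simp add: barrier_fun_def field_simps)
  finally show ?thesis .
qed

text \<open>Changes of the barrier parameter contribute \<open>- (\<mu> 0 - \<mu> n) * ?l\<close> in
  total, and the last objective value is at least \<open>(1 + \<mu> n) * ?l\<close>. Together this
  is \<open>(1 + \<mu> 0) * ?l\<close>, at least \<open>2 * ?l\<close> since
  \<open>?l \<le> 0\<close>; hence the shape of \<open>init_gap\<close>.\<close>

lemma sum_stationarity_bound: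
  fixes y g :: "nat \<Rightarrow> real^'n"
  assumes y0: "y 0 \<in> F" and y: "\<And>k. y (Suc k) = SIPM_step B A (\<eta> k) (\<mu> k) (y k) (g k)"
    and \<eta>: "\<And>k. 0 \<le> \<eta> k" "\<And>k. \<eta> k \<le> s"
    and \<mu>: "\<And>k. 0 < \<mu> k" "\<And>k. \<mu> k \<le> 1" "\<And>k. \<mu> (Suc k) \<le> \<mu> k"
  shows "(\<Sum>k<n. \<eta> k * stationarity f B A (\<mu> k) (y k) (g k))
    \<le> init_gap f B \<phi>low (y 0) + 4 * (\<Sum>k<n. \<eta> k * dual_norm B (y k) (g k - grad f (y k)))
      + L\<phi> / 2 * (\<Sum>k<n. (\<eta> k)\<^sup>2)"
proof -
  have yF: "y k \<in> F" for k
    by (induction k) (auto simp: y0 y intro!: SIPM_step_in_F \<eta>)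
  define S E Q where "S n = (\<Sum>k<n. \<eta> k * stationarity f B A (\<mu> k) (y k) (g k))"
    and "E n = (\<Sum>k<n. \<eta> k * dual_norm B (y k) (g k - grad f (y k)))"
    and "Q n = (\<Sum>k<n. (\<eta> k)\<^sup>2)" for n
  let ?l = "min \<phi>low 0"
  have main: "barrier_fun f B (\<mu> n) (y n) + S n
      \<le> barrier_fun f B (\<mu> 0) (y 0) + 4 * E n + L\<phi> / 2 * Q n - (\<mu> 0 - \<mu> n) * ?l"
  proof (induction n)
    case (Suc n)
    have "?l \<le> f (y (Suc n)) + B (y (Suc n))"
      using lower_bound[OF yF, of 1 "Suc n"] by simp
    then have "(\<mu> n - \<mu> (Suc n)) * ?l \<le> (\<mu> n - \<mu> (Suc n)) * (f (y (Suc n)) + B (y (Suc n)))"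
      using \<mu>(3)[of n] by (intro mult_left_mono) auto
    then have "barrier_fun f B (\<mu> (Suc n)) (y (Suc n))
        \<le> barrier_fun f B (\<mu> n) (y (Suc n)) - (\<mu> n - \<mu> (Suc n)) * ?l"
      by (simp add: barrier_fun_def algebra_simps)
    moreover have "barrier_fun f B (\<mu> n) (y (Suc n)) \<le> barrier_fun f B (\<mu> n) (y n)
        - \<eta> n * stationarity f B A (\<mu> n) (y n) (g n)
        + 4 * (\<eta> n * dual_norm B (y n) (g n - grad f (y n))) + L\<phi> / 2 * (\<eta> n)\<^sup>2"
      unfolding y by (rule descent[OF yF \<eta> \<mu>(1,2)])
    ultimately show ?case using Suc by (simp add: S_def E_def Q_def algebra_simps)
  qed (simp add: S_def E_def Q_def)
  have "\<mu> 0 * (f (y 0) + B (y 0)) \<le> max (f (y 0) + B (y 0)) 0"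
  proof (cases "0 \<le> f (y 0) + B (y 0)")
    case True
    then show ?thesis using mult_right_mono[OF \<mu>(2)[of 0] True] by simp
  next
    case False
    then have "\<mu> 0 * (f (y 0) + B (y 0)) \<le> 0" using \<mu>(1)[of 0] by (intro mult_nonneg_nonpos) auto
    then show ?thesis by simp
  qed
  then have "barrier_fun f B (\<mu> 0) (y 0) \<le> f (y 0) + max (f (y 0) + B (y 0)) 0"
    by (simp add: barrier_fun_def)
  moreover have "2 * ?l \<le> (1 + \<mu> 0) * ?l"
    using \<mu>(2)[of 0] by (intro mult_right_mono_neg) auto
  moreover have "(1 + \<mu> n) * ?l \<le> barrier_fun f B (\<mu> n) (y n)"
    by (rule barrier_fun_lower_bound[OF yF \<mu>(1,2)])
  moreover have "(1 + \<mu> 0) * ?l = (1 + \<mu> n) * ?l + (\<mu> 0 - \<mu> n) * ?l" by (simp add: algebra_simps)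
  ultimately have "S n \<le> init_gap f B \<phi>low (y 0) + 4 * E n + L\<phi> / 2 * Q n"
    using main unfolding init_gap_def by linarith
  then show ?thesis by (simp add: S_def E_def Q_def)
qed

text \<open>The summed bound for the empty sum, applied to a run from \<open>y\<close> with step
  size 0.\<close>

lemma init_gap_nonneg: "y \<in> F \<Longrightarrow> 0 \<le> init_gap f B \<phi>low y"
  using sum_stationarity_bound[of "\<lambda>n. (((\<lambda>y. SIPM_step B A 0 1 y 0)) ^^ n) y" "\<lambda>_. 0" "\<lambda>_. 1" "\<lambda>_. 0" 0] s
  by simp

end

section \<open>Sampling\<close>

lemma measurable_matrix_vector_mult:
  fixes Q :: "'a \<Rightarrow> real^'n^'m"
  assumes "Q \<in> borel_measurable M" "v \<in> borel_measurable M"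
  shows "(\<lambda>\<omega>. Q \<omega> *v v \<omega>) \<in> borel_measurable M"
  using assms
  by (rule borel_measurable_continuous_Pair)
    (auto simp: matrix_vector_mult_def intro!: continuous_intros)

lemma measurable_quad_norm:
  assumes "Q \<in> borel_measurable M" "v \<in> borel_measurable M"
  shows "(\<lambda>\<omega>. quad_norm (Q \<omega>) (v \<omega>)) \<in> borel_measurable M"
  unfolding quad_norm_def using assms by (intro measurable_compose[OF _ borel_measurable_sqrt]
      borel_measurable_inner measurable_matrix_vector_mult)

lemma continuous_on_matrix_mult:
  fixes P :: "'a::topological_space \<Rightarrow> real^'n^'m" and Q :: "'a \<Rightarrow> real^'k^'n"
  assumes "continuous_on S P" "continuous_on S Q"
  shows "continuous_on S (\<lambda>y. P y ** Q y)"
  unfolding matrix_matrix_mult_def by (intro continuous_intros assms)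

lemma (in prob_space) indep_vars_pair:
  assumes "indep_vars N X I" "i \<in> I" "j \<in> I" "i \<noteq> j"
  shows "indep_var (N i) (X i) (N j) (X j)"
proof -
  have "indep_var (PiM {i} N) (\<lambda>\<omega>. restrict (\<lambda>k. X k \<omega>) {i}) (PiM {j} N) (\<lambda>\<omega>. restrict (\<lambda>k. X k \<omega>) {j})"
    using assms by (intro indep_var_restrict) auto
  then have "indep_var (N i) ((\<lambda>z. z i) \<circ> (\<lambda>\<omega>. restrict (\<lambda>k. X k \<omega>) {i}))
      (N j) ((\<lambda>z. z j) \<circ> (\<lambda>\<omega>. restrict (\<lambda>k. X k \<omega>) {j}))"
    by (rule indep_var_compose) (auto intro: measurable_component_singleton)
  then show ?thesis by (simp add: comp_def)
qed

text \<open>The square of the mean expands into a double sum. Off-diagonal terms vanish in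
  expectation by independence and centring, and the \<open>n\<close> diagonal terms are divided by
  \<open>n\<^sup>2\<close>. The matrix and the centre are deterministic here: the random iterate is
  frozen beforehand.\<close>

lemma (in prob_space) minibatch_variance:
  fixes h :: "'s \<Rightarrow> real^'n"
  assumes J: "finite J" "J \<noteq> {}"
    and ind: "indep_vars (\<lambda>_. D) X J"
    and law: "\<And>i. i \<in> J \<Longrightarrow> distr M D (X i) = D"
    and h: "integrable D h" "(LINT s|D. h s) = c"
    and Q: "sym_pd Q"
    and var: "integrable D (\<lambda>s. (quad_norm Q (h s - c))\<^sup>2)" "(LINT s|D. (quad_norm Q (h s - c))\<^sup>2) \<le> V"
  defines "E \<equiv> \<lambda>\<omega>. (quad_norm Q ((1 / real (card J)) *\<^sub>R (\<Sum>i\<in>J. h (X i \<omega>)) - c))\<^sup>2"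
  shows "integrable M E" "expectation E \<le> V / real (card J)"
proof -
  define n where "n = real (card J)"
  have n: "0 < n" using J by (simp add: n_def card_gt_0_iff)
  have X: "X i \<in> measurable M D" if "i \<in> J" for i
    using ind that by (auto simp: indep_vars_def)
  define Y where "Y i \<omega> = h (X i \<omega>) - c" for i \<omega>
  have hm: "h \<in> borel_measurable D" using h by auto
  have E_eq: "E \<omega> = (1 / n\<^sup>2) * (\<Sum>i\<in>J. \<Sum>j\<in>J. Y i \<omega> \<bullet> (Q *v Y j \<omega>))" for \<omega>
  proof -
    have "(1 / real (card J)) *\<^sub>R (\<Sum>i\<in>J. h (X i \<omega>)) - c = (1 / n) *\<^sub>R (\<Sum>i\<in>J. Y i \<omega>)"
      using n by (simp add: Y_def sum_subtractf scaleR_diff_right n_def sum_constant_scaleR del: sum_constant)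
    then have "E \<omega> = (1 / n)\<^sup>2 * (quad_norm Q (\<Sum>i\<in>J. Y i \<omega>))\<^sup>2"
      by (simp add: E_def quad_norm_scaleR power_mult_distrib power_divide)
    also have "(quad_norm Q (\<Sum>i\<in>J. Y i \<omega>))\<^sup>2 = (\<Sum>i\<in>J. \<Sum>j\<in>J. Y i \<omega> \<bullet> (Q *v Y j \<omega>))"
      by (subst sum.swap) (simp add: quad_norm_square[OF Q] inner_sum_left inner_sum_right
          linear_sum[OF matrix_vector_mul_linear])
    finally show ?thesis by (simp add: power_divide)
  qed
  have diag: "integrable M (\<lambda>\<omega>. Y i \<omega> \<bullet> (Q *v Y i \<omega>))"
      "expectation (\<lambda>\<omega>. Y i \<omega> \<bullet> (Q *v Y i \<omega>)) \<le> V" if i: "i \<in> J" for i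
  proof -
    have "integrable (distr M D (X i)) (\<lambda>s. (quad_norm Q (h s - c))\<^sup>2)"
      using var law[OF i] by simp
    then show "integrable M (\<lambda>\<omega>. Y i \<omega> \<bullet> (Q *v Y i \<omega>))"
      using integrable_distr[OF X[OF i]] by (simp add: Y_def quad_norm_square[OF Q])
    have "(LINT s|distr M D (X i). (quad_norm Q (h s - c))\<^sup>2) \<le> V"
      using var law[OF i] by simp
    then show "expectation (\<lambda>\<omega>. Y i \<omega> \<bullet> (Q *v Y i \<omega>)) \<le> V"
      using var by (subst (asm) integral_distr[OF X[OF i]]) (auto simp: Y_def quad_norm_square[OF Q])
  qed
  have Yint: "integrable M (Y i)" "expectation (Y i) = 0" if i: "i \<in> J" for i
  proof -
    have "integrable (distr M D (X i)) h" using h law[OF i] by simp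
    from integrable_distr[OF X[OF i] this] have hi: "integrable M (\<lambda>\<omega>. h (X i \<omega>))" .
    have "expectation (\<lambda>\<omega>. h (X i \<omega>)) = integral\<^sup>L (distr M D (X i)) h"
      by (rule integral_distr[symmetric, OF X[OF i] hm])
    then have "expectation (\<lambda>\<omega>. h (X i \<omega>)) = c" using law[OF i] h by simp
    then show "integrable M (Y i)" "expectation (Y i) = 0"
      using hi unfolding Y_def by (simp_all add: prob_space)
  qed
  have off: "integrable M (\<lambda>\<omega>. Y i \<omega> \<bullet> (Q *v Y j \<omega>))"
      "expectation (\<lambda>\<omega>. Y i \<omega> \<bullet> (Q *v Y j \<omega>)) = 0" if ij: "i \<in> J" "j \<in> J" "i \<noteq> j" for i j
  proof -
    \<comment> \<open>Products of independent variables are handled for real values, so the inner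
      product is split into coordinates.\<close>
    have iv: "indep_var borel ((\<lambda>s. (h s - c) \<bullet> b) \<circ> X i) borel ((\<lambda>s. (Q *v (h s - c)) \<bullet> b) \<circ> X j)" for b
    proof (rule indep_var_compose)
      show "indep_var D (X i) D (X j)" by (rule indep_vars_pair[OF ind ij])
      show "(\<lambda>s. (Q *v (h s - c)) \<bullet> b) \<in> borel_measurable D"
        using hm by (intro borel_measurable_inner measurable_matrix_vector_mult) auto
    qed (use hm in auto)
    have Q_int: "integrable M (\<lambda>\<omega>. Q *v Y j \<omega>)"
      using Yint[OF ij(2)] by (intro integrable_bounded_linear[OF matrix_vector_mul_bounded_linear])
    have a: "integrable M ((\<lambda>s. (h s - c) \<bullet> b) \<circ> X i)" "integrable M ((\<lambda>s. (Q *v (h s - c)) \<bullet> b) \<circ> X j)"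
      "expectation ((\<lambda>s. (h s - c) \<bullet> b) \<circ> X i) = 0" for b
      using Yint[OF ij(1)] Q_int unfolding Y_def comp_def by auto
    have eq: "(\<lambda>\<omega>. Y i \<omega> \<bullet> (Q *v Y j \<omega>)) = (\<lambda>\<omega>. \<Sum>b\<in>Basis.
        ((\<lambda>s. (h s - c) \<bullet> b) \<circ> X i) \<omega> * ((\<lambda>s. (Q *v (h s - c)) \<bullet> b) \<circ> X j) \<omega>)"
      unfolding Y_def comp_def by (rule ext, rule euclidean_inner)
    have 1: "integrable M (\<lambda>\<omega>. ((\<lambda>s. (h s - c) \<bullet> b) \<circ> X i) \<omega> * ((\<lambda>s. (Q *v (h s - c)) \<bullet> b) \<circ> X j) \<omega>)" for b
      by (rule indep_var_integrable[OF iv a(1) a(2)])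
    have 2: "expectation (\<lambda>\<omega>. ((\<lambda>s. (h s - c) \<bullet> b) \<circ> X i) \<omega> * ((\<lambda>s. (Q *v (h s - c)) \<bullet> b) \<circ> X j) \<omega>) = 0" for b
      by (subst indep_var_lebesgue_integral[OF iv a(1) a(2)]) (simp add: a(3))
    show "integrable M (\<lambda>\<omega>. Y i \<omega> \<bullet> (Q *v Y j \<omega>))"
      unfolding eq by (intro Bochner_Integration.integrable_sum 1)
    show "expectation (\<lambda>\<omega>. Y i \<omega> \<bullet> (Q *v Y j \<omega>)) = 0"
      unfolding eq by (subst Bochner_Integration.integral_sum) (use 1 2 in auto)
  qed
  have int: "integrable M (\<lambda>\<omega>. Y i \<omega> \<bullet> (Q *v Y j \<omega>))" if "i \<in> J" "j \<in> J" for i j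
    using diag off that by (cases "i = j") auto
  show "integrable M E"
    unfolding E_eq using int by (intro integrable_mult_right Bochner_Integration.integrable_sum) auto
  have "expectation E = (1 / n\<^sup>2) * (\<Sum>i\<in>J. \<Sum>j\<in>J. expectation (\<lambda>\<omega>. Y i \<omega> \<bullet> (Q *v Y j \<omega>)))"
    unfolding E_eq using int by (simp add: Bochner_Integration.integral_sum)
  also have "(\<Sum>i\<in>J. \<Sum>j\<in>J. expectation (\<lambda>\<omega>. Y i \<omega> \<bullet> (Q *v Y j \<omega>)))
      = (\<Sum>i\<in>J. \<Sum>j\<in>J. if i = j then expectation (\<lambda>\<omega>. Y i \<omega> \<bullet> (Q *v Y i \<omega>)) else 0)"
    using off(2) by (intro sum.cong refl) auto
  also have "\<dots> = (\<Sum>i\<in>J. expectation (\<lambda>\<omega>. Y i \<omega> \<bullet> (Q *v Y i \<omega>)))"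
    using J by (intro sum.cong refl) (simp add: sum.delta')
  also have "(1 / n\<^sup>2) * \<dots> \<le> (1 / n\<^sup>2) * (\<Sum>i\<in>J. V)"
    using diag(2) by (intro mult_left_mono sum_mono) auto
  also have "\<dots> = V / n" using n by (simp add: n_def power2_eq_square)
  finally show "expectation E \<le> V / real (card J)" by (simp add: n_def)
qed

section \<open>Measurability of one step\<close>

lemma (in conic_problem) F_subset: "F \<subseteq> interior K" "F \<subseteq> feasible K A b"
  using interior_subset[of K] by (auto simp: strictly_feasible_def feasible_def)

lemma (in conic_problem) continuous_on_F:
  shows "continuous_on F (grad f)" "continuous_on F (grad B)"
    "continuous_on F (\<lambda>y. matrix_inv (hess B y))"
    "continuous_on F (\<lambda>y. matrix_inv (A ** matrix_inv (hess B y) ** transpose A))"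
    "continuous_on F (grad (barrier_fun f B t))"
proof -
  show f: "continuous_on F (grad f)"
    by (rule continuous_on_subset[OF continuous_on_grad[OF f_C1] F_subset(2)])
  show B: "continuous_on F (grad B)"
    by (rule continuous_on_subset[OF continuous_on_grad_B F_subset(1)])
  show H: "continuous_on F (\<lambda>y. matrix_inv (hess B y))"
    by (rule continuous_on_subset[OF continuous_on_inv_hess F_subset(1)])
  show "continuous_on F (\<lambda>y. matrix_inv (A ** matrix_inv (hess B y) ** transpose A))"
    by (intro continuous_on_matrix_inv continuous_on_matrix_mult continuous_on_const H
        normal_matrix_invertible full_row_rank sym_pd_matrix_inv F_sym_pd)
  have "continuous_on F (\<lambda>y. (1 + t) *\<^sub>R grad f y + t *\<^sub>R grad B y)"
    by (intro continuous_intros f B)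
  then show "continuous_on F (grad (barrier_fun f B t))"
    by (rule continuous_on_eq) (simp add: grad_barrier_fun)
qed

context conic_problem
begin

text \<open>Continuity of the gradients and inverse matrices is available on the strictly feasible
  set, and \<open>G\<close> is jointly measurable over it. The iterates must therefore be measurable
  into this subspace, not merely into the ambient space.\<close>

abbreviation F_borel :: "(real^'n) measure" where "F_borel \<equiv> restrict_space borel F"

context
  fixes N :: "'a measure" and y :: "'a \<Rightarrow> real^'n"
  assumes y: "y \<in> measurable N F_borel"
begin

lemma measurable_on_F: "continuous_on F h \<Longrightarrow> (\<lambda>\<omega>. h (y \<omega>)) \<in> borel_measurable N"
  by (rule measurable_compose[OF y borel_measurable_continuous_on_restrict])

lemma y_borel: "y \<in> borel_measurable N"
  using y by (simp add: measurable_restrict_space2_iff)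

lemma measurable_dual_norm:
  "v \<in> borel_measurable N \<Longrightarrow> (\<lambda>\<omega>. dual_norm B (y \<omega>) (v \<omega>)) \<in> borel_measurable N"
  unfolding dual_norm_quad
  by (intro measurable_quad_norm measurable_on_F[OF continuous_on_F(3)])

context
  fixes g :: "'a \<Rightarrow> real^'n"
  assumes g: "g \<in> borel_measurable N"
begin

lemma measurable_momentum: "(\<lambda>\<omega>. momentum B t (y \<omega>) (g \<omega>)) \<in> borel_measurable N"
  unfolding momentum_def
  by (intro borel_measurable_add borel_measurable_scaleR borel_measurable_const g
      measurable_on_F[OF continuous_on_F(2)])

lemma measurable_multiplier: "(\<lambda>\<omega>. multiplier B A t (y \<omega>) (g \<omega>)) \<in> borel_measurable N"
  unfolding multiplier_def
  by (intro borel_measurable_uminus measurable_matrix_vector_mult borel_measurable_const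
      measurable_momentum measurable_on_F[OF continuous_on_F(3)] measurable_on_F[OF continuous_on_F(4)])

lemma measurable_direction: "(\<lambda>\<omega>. direction B A t (y \<omega>) (g \<omega>)) \<in> borel_measurable N"
  unfolding direction_def
  by (intro borel_measurable_add measurable_matrix_vector_mult borel_measurable_const
      measurable_momentum measurable_multiplier)

lemma measurable_stationarity: "(\<lambda>\<omega>. stationarity f B A t (y \<omega>) (g \<omega>)) \<in> borel_measurable N"
  unfolding stationarity_def
  by (intro measurable_dual_norm borel_measurable_add measurable_matrix_vector_mult
      borel_measurable_const measurable_multiplier measurable_on_F[OF continuous_on_F(5)])

lemma measurable_SIPM_step:
  assumes e: "0 \<le> e" "e \<le> s"
  shows "(\<lambda>\<omega>. SIPM_step B A e t (y \<omega>) (g \<omega>)) \<in> measurable N F_borel"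
proof (rule measurable_restrict_space2)
  show "(\<lambda>\<omega>. SIPM_step B A e t (y \<omega>) (g \<omega>)) \<in> space N \<rightarrow> F"
    using measurable_space[OF y] by (auto simp: space_restrict_space intro!: SIPM_step_in_F e)
  show "(\<lambda>\<omega>. SIPM_step B A e t (y \<omega>) (g \<omega>)) \<in> borel_measurable N"
    unfolding SIPM_step_def
    by (intro borel_measurable_diff borel_measurable_scaleR borel_measurable_divide
        borel_measurable_const measurable_dual_norm measurable_direction
        measurable_matrix_vector_mult y_borel measurable_on_F[OF continuous_on_F(3)])
qed

end

end

end

section \<open>The random iterates and the errors of their gradient estimates\<close>

locale stochastic_SIPM = conic_problem K \<theta> B A b f \<phi>low L s + prob_space M
  for K :: "(real^'n) set" and \<theta> :: real and B :: "real^'n \<Rightarrow> real"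
    and A :: "real^'n^'m" and b :: "real^'m" and f :: "real^'n \<Rightarrow> real" and \<phi>low L s :: real
    and M :: "'w measure" +
  fixes x0 :: "real^'n" and \<eta> \<mu> :: "nat \<Rightarrow> real" and D :: "'s measure"
    and G :: "real^'n \<Rightarrow> 's \<Rightarrow> real^'n" and \<B> :: "nat \<Rightarrow> 'i set"
    and X :: "nat \<times> 'i \<Rightarrow> 'w \<Rightarrow> 's" and \<sigma> :: real
  assumes x0: "x0 \<in> F"
    and \<eta>: "\<And>k. 0 < \<eta> k" "\<And>k. \<eta> k \<le> s"
    and \<mu>: "\<And>k. 0 < \<mu> k" "\<And>k. \<mu> k \<le> 1" "\<And>k. \<mu> (Suc k) \<le> \<mu> k"
    and \<sigma>: "0 < \<sigma>"
    and G_measurable: "(\<lambda>(y, s). G y s) \<in> borel_measurable (restrict_space borel F \<Otimes>\<^sub>M D)"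
    and G_unbiased: "\<And>y. y \<in> F \<Longrightarrow> integrable D (G y) \<and> (LINT s|D. G y s) = grad f y"
    and G_variance: "\<And>y. y \<in> F \<Longrightarrow>
        integrable D (\<lambda>s. (dual_norm B y (G y s - grad f y))\<^sup>2) \<and>
        (LINT s|D. (dual_norm B y (G y s - grad f y))\<^sup>2) \<le> \<sigma>\<^sup>2"
    and batch: "\<And>k. finite (\<B> k)" "\<And>k. \<B> k \<noteq> {}"
    and X_law: "\<And>p. p \<in> Sigma UNIV \<B> \<Longrightarrow> distr M D (X p) = D"
    and X_indep: "indep_vars (\<lambda>_. D) X (Sigma UNIV \<B>)"
begin

text \<open>Here \<open>z\<close> is an arbitrary array of samples; randomness enters only by
  inserting \<open>path\<close>. Dependence on the past alone then becomes a congruence property in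
  \<open>z\<close>.\<close>

definition estimate :: "nat \<Rightarrow> (nat \<times> 'i \<Rightarrow> 's) \<Rightarrow> real^'n \<Rightarrow> real^'n" where
  "estimate k z y = minibatch G (\<B> k) (\<lambda>i. z (k, i)) y"

primrec iterate :: "nat \<Rightarrow> (nat \<times> 'i \<Rightarrow> 's) \<Rightarrow> real^'n" where
  "iterate 0 z = x0"
| "iterate (Suc k) z = SIPM_step B A (\<eta> k) (\<mu> k) (iterate k z) (estimate k z (iterate k z))"

text \<open>The point is an argument separate from the array, so that it can be frozen while the
  present batch varies.\<close>

definition error :: "nat \<Rightarrow> (nat \<times> 'i \<Rightarrow> 's) \<Rightarrow> real^'n \<Rightarrow> real" where
  "error k z y = dual_norm B y (estimate k z y - grad f y)"

definition residual :: "nat \<Rightarrow> (nat \<times> 'i \<Rightarrow> 's) \<Rightarrow> real" where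
  "residual k z = stationarity f B A (\<mu> k) (iterate k z) (estimate k z (iterate k z))"

abbreviation past :: "nat \<Rightarrow> (nat \<times> 'i) set" where "past k \<equiv> Sigma {..<k} \<B>"

abbreviation present :: "nat \<Rightarrow> (nat \<times> 'i) set" where "present k \<equiv> Sigma {k} \<B>"

lemma iterate_in_F: "iterate k z \<in> F"
  by (induction k) (auto simp: x0 intro!: SIPM_step_in_F \<eta> less_imp_le)

lemma estimate_cong: "(\<And>p. p \<in> present k \<Longrightarrow> z p = z' p) \<Longrightarrow> estimate k z y = estimate k z' y"
  unfolding estimate_def minibatch_def by (auto intro!: sum.cong arg_cong[where f="G y"])

lemma iterate_cong: "(\<And>p. p \<in> past k \<Longrightarrow> z p = z' p) \<Longrightarrow> iterate k z = iterate k z'"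
proof (induction k)
  case (Suc k)
  then have "iterate k z = iterate k z'" by auto
  moreover have "estimate k z y = estimate k z' y" for y
    using Suc.prems by (intro estimate_cong) auto
  ultimately show ?case by simp
qed simp

lemma measurable_estimate:
  assumes y: "y \<in> measurable N F_borel" and z: "\<And>p. p \<in> present k \<Longrightarrow> (\<lambda>\<omega>. z \<omega> p) \<in> measurable N D"
  shows "(\<lambda>\<omega>. estimate k (z \<omega>) (y \<omega>)) \<in> borel_measurable N"
proof -
  have "(\<lambda>\<omega>. G (y \<omega>) (z \<omega> (k, i))) \<in> borel_measurable N" if "i \<in> \<B> k" for i
    using measurable_compose[OF measurable_Pair[OF y z[of "(k, i)"]] G_measurable] that by simp
  then show ?thesis
    unfolding estimate_def minibatch_def
    by (intro borel_measurable_scaleR borel_measurable_const borel_measurable_sum) auto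
qed

text \<open>The index set \<open>J\<close> is free because both the product over the past and the
  product over all samples occur.\<close>

lemma measurable_iterate:
  "past k \<subseteq> J \<Longrightarrow> iterate k \<in> measurable (PiM J (\<lambda>_. D)) F_borel"
proof (induction k)
  case 0
  then show ?case by (auto intro!: measurable_restrict_space2 simp: x0)
next
  case (Suc k)
  have y: "iterate k \<in> measurable (PiM J (\<lambda>_. D)) F_borel"
    using Suc.prems by (intro Suc.IH order.trans[OF _ Suc.prems] Sigma_mono) auto
  have "(\<lambda>z. estimate k z (iterate k z)) \<in> borel_measurable (PiM J (\<lambda>_. D))"
    using Suc.prems by (intro measurable_estimate y measurable_component_singleton) auto
  from measurable_SIPM_step[OF y this less_imp_le[OF \<eta>(1)] \<eta>(2)]
  show ?case by simp
qed

text \<open>Restriction sets the other coordinates to \<open>undefined\<close>, as the space of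
  \<open>PiM\<close> requires.\<close>

abbreviation path :: "'w \<Rightarrow> nat \<times> 'i \<Rightarrow> 's" where
  "path \<omega> \<equiv> restrict (\<lambda>p. X p \<omega>) (Sigma UNIV \<B>)"

lemma X_measurable: "p \<in> Sigma UNIV \<B> \<Longrightarrow> X p \<in> measurable M D"
  using X_indep by (auto simp: indep_vars_def)

lemma path_measurable: "path \<in> measurable M (PiM (Sigma UNIV \<B>) (\<lambda>_. D))"
  by (rule measurable_restrict) (rule X_measurable)

lemma measurable_residual:
  "residual k \<in> borel_measurable (PiM (Sigma UNIV \<B>) (\<lambda>_. D))"
  unfolding residual_def
  by (intro measurable_stationarity measurable_estimate measurable_iterate
      measurable_component_singleton) auto

text \<open>The current iterate only depends on the samples of the past, which are independent of
  those of the present; by Fubini, the iterate may be held fixed.\<close>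
lemma nn_error_bound:
  "(\<integral>\<^sup>+\<omega>. ennreal ((error k (path \<omega>) (iterate k (path \<omega>)))\<^sup>2) \<partial>M) \<le> ennreal (\<sigma>\<^sup>2 / real (card (\<B> k)))"
proof -
  let ?P = "PiM (past k) (\<lambda>_. D)" and ?Q = "PiM (present k) (\<lambda>_. D)"
  let ?Z1 = "\<lambda>\<omega>. restrict (\<lambda>p. X p \<omega>) (past k)" and ?Z2 = "\<lambda>\<omega>. restrict (\<lambda>p. X p \<omega>) (present k)"
  let ?V = "ennreal (\<sigma>\<^sup>2 / real (card (\<B> k)))"
  have ind: "indep_var ?P ?Z1 ?Q ?Z2"
    by (rule indep_var_restrict[OF X_indep]) auto
  note Z1 = indep_var_rv1[OF ind] and Z2 = indep_var_rv2[OF ind]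
  \<comment> \<open>The error as a function of past and present separately. It takes extended
    nonnegative values because integrability is not yet known.\<close>
  define \<Phi> where "\<Phi> q = ennreal ((error k (snd q) (iterate k (fst q)))\<^sup>2)" for q
  have it: "(\<lambda>q. iterate k (fst q)) \<in> measurable (?P \<Otimes>\<^sub>M ?Q) F_borel"
    by (rule measurable_compose[OF measurable_fst measurable_iterate]) simp
  have es: "(\<lambda>q. estimate k (snd q) (iterate k (fst q))) \<in> borel_measurable (?P \<Otimes>\<^sub>M ?Q)"
    by (intro measurable_estimate it measurable_compose[OF measurable_snd measurable_component_singleton])
  have "(\<lambda>q. error k (snd q) (iterate k (fst q))) \<in> borel_measurable (?P \<Otimes>\<^sub>M ?Q)"
    unfolding error_def
    by (intro measurable_dual_norm it borel_measurable_diff es measurable_on_F[OF it continuous_on_F(1)])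
  then have \<Phi>: "\<Phi> \<in> borel_measurable (?P \<Otimes>\<^sub>M ?Q)"
    unfolding \<Phi>_def by measurable
  interpret Q: prob_space "distr M ?Q ?Z2" by (rule prob_space_distr[OF Z2])
  interpret P: prob_space "distr M ?P ?Z1" by (rule prob_space_distr[OF Z1])
  have inner: "(\<integral>\<^sup>+ z2. \<Phi> (z1, z2) \<partial>distr M ?Q ?Z2) \<le> ?V" if z1: "z1 \<in> space ?P" for z1
  proof -
    define y where "y = iterate k z1"
    have y: "y \<in> F" by (simp add: y_def iterate_in_F)
    have m: "(\<lambda>z2. \<Phi> (z1, z2)) \<in> borel_measurable ?Q"
      using measurable_compose[OF measurable_Pair1'[OF z1] \<Phi>] by (simp add: comp_def)
    have "(\<integral>\<^sup>+ z2. \<Phi> (z1, z2) \<partial>distr M ?Q ?Z2) = (\<integral>\<^sup>+ \<omega>. \<Phi> (z1, ?Z2 \<omega>) \<partial>M)"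
      by (rule nn_integral_distr[OF Z2]) (use m in simp)
    also have "\<dots> = (\<integral>\<^sup>+ \<omega>. ennreal ((error k (\<lambda>p. X p \<omega>) y)\<^sup>2) \<partial>M)"
    proof (rule nn_integral_cong)
      fix \<omega>
      have "estimate k (?Z2 \<omega>) y = estimate k (\<lambda>p. X p \<omega>) y" by (rule estimate_cong) simp
      then show "\<Phi> (z1, ?Z2 \<omega>) = ennreal ((error k (\<lambda>p. X p \<omega>) y)\<^sup>2)"
        by (simp add: \<Phi>_def error_def y_def)
    qed
    also have "\<dots> \<le> ?V"
    proof -
      have J: "finite (present k)" "present k \<noteq> {}" "card (present k) = card (\<B> k)"
        using batch[of k] by auto
      have hsum: "(\<Sum>i\<in>\<B> k. G y (X (k, i) \<omega>)) = (\<Sum>p\<in>present k. G y (X p \<omega>))" for \<omega>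
        by (rule sum.reindex_bij_witness[of _ snd "Pair k"]) auto
      note mv = minibatch_variance[OF J(1,2) indep_vars_subset[OF X_indep] X_law
          G_unbiased[OF y, THEN conjunct1] G_unbiased[OF y, THEN conjunct2]
          sym_pd_matrix_inv[OF F_sym_pd[OF y]]
          G_variance[OF y, THEN conjunct1, unfolded dual_norm_quad]
          G_variance[OF y, THEN conjunct2, unfolded dual_norm_quad]]
      have eq: "error k (\<lambda>p. X p \<omega>) y = quad_norm (matrix_inv (hess B y))
          ((1 / real (card (present k))) *\<^sub>R (\<Sum>p\<in>present k. G y (X p \<omega>)) - grad f y)" for \<omega>
        by (simp add: error_def dual_norm_quad estimate_def minibatch_def hsum J)
      have "integrable M (\<lambda>\<omega>. (error k (\<lambda>p. X p \<omega>) y)\<^sup>2)"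
        "expectation (\<lambda>\<omega>. (error k (\<lambda>p. X p \<omega>) y)\<^sup>2) \<le> \<sigma>\<^sup>2 / real (card (\<B> k))"
        unfolding eq using mv J(3) by auto
      then show ?thesis
        by (subst nn_integral_eq_integral) (auto intro: ennreal_leI)
    qed
    finally show ?thesis .
  qed
  have "(\<integral>\<^sup>+\<omega>. ennreal ((error k (path \<omega>) (iterate k (path \<omega>)))\<^sup>2) \<partial>M)
      = (\<integral>\<^sup>+\<omega>. \<Phi> (?Z1 \<omega>, ?Z2 \<omega>) \<partial>M)"
  proof (rule nn_integral_cong)
    fix \<omega>
    have 1: "iterate k (path \<omega>) = iterate k (?Z1 \<omega>)" by (rule iterate_cong) auto
    have "estimate k (path \<omega>) y = estimate k (?Z2 \<omega>) y" for y by (rule estimate_cong) auto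
    then show "ennreal ((error k (path \<omega>) (iterate k (path \<omega>)))\<^sup>2) = \<Phi> (?Z1 \<omega>, ?Z2 \<omega>)"
      unfolding \<Phi>_def error_def 1 by simp
  qed
  also have "\<dots> = (\<integral>\<^sup>+q. \<Phi> q \<partial>distr M (?P \<Otimes>\<^sub>M ?Q) (\<lambda>\<omega>. (?Z1 \<omega>, ?Z2 \<omega>)))"
    by (rule nn_integral_distr[symmetric, OF measurable_Pair[OF Z1 Z2]]) (use \<Phi> in simp)
  also have "distr M (?P \<Otimes>\<^sub>M ?Q) (\<lambda>\<omega>. (?Z1 \<omega>, ?Z2 \<omega>)) = distr M ?P ?Z1 \<Otimes>\<^sub>M distr M ?Q ?Z2"
    using ind by (simp add: indep_var_distribution_eq)
  also have "(\<integral>\<^sup>+q. \<Phi> q \<partial>(distr M ?P ?Z1 \<Otimes>\<^sub>M distr M ?Q ?Z2))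
      = (\<integral>\<^sup>+z1. \<integral>\<^sup>+z2. \<Phi> (z1, z2) \<partial>distr M ?Q ?Z2 \<partial>distr M ?P ?Z1)"
  proof (rule Q.nn_integral_fst[symmetric])
    show "\<Phi> \<in> borel_measurable (distr M ?P ?Z1 \<Otimes>\<^sub>M distr M ?Q ?Z2)"
      using \<Phi> by (simp cong: measurable_cong_sets sets_pair_measure_cong)
  qed
  also have "\<dots> \<le> (\<integral>\<^sup>+z1. ?V \<partial>distr M ?P ?Z1)"
    by (intro nn_integral_mono inner) simp
  also have "\<dots> = ?V" using P.emeasure_space_1 by (simp only: nn_integral_const mult_1_right)
  finally show ?thesis .
qed

lemma error_measurable: "(\<lambda>\<omega>. error k (path \<omega>) (iterate k (path \<omega>))) \<in> borel_measurable M"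
proof -
  have it: "(\<lambda>\<omega>. iterate k (path \<omega>)) \<in> measurable M F_borel"
    by (rule measurable_compose[OF path_measurable measurable_iterate]) auto
  have "(\<lambda>\<omega>. estimate k (path \<omega>) (iterate k (path \<omega>))) \<in> borel_measurable M"
    by (intro measurable_estimate it measurable_compose[OF path_measurable measurable_component_singleton]) auto
  then show ?thesis
    unfolding error_def
    by (intro measurable_dual_norm it borel_measurable_diff measurable_on_F[OF it continuous_on_F(1)])
qed

text \<open>From the second moment to the first by
  \<open>e \<le> e\<^sup>2 / (2 * c) + c / 2\<close>; with \<open>c = \<sigma> / sqrt n\<close> for
  batch size \<open>n\<close>, both terms are at most \<open>c / 2\<close> in expectation. The
  right-hand side also serves as the integrable majorant.\<close>

lemma error_expectation:
  defines "e \<equiv> \<lambda>k \<omega>. error k (path \<omega>) (iterate k (path \<omega>))"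
  shows "integrable M (e k)" "expectation (e k) \<le> \<sigma> / sqrt (real (card (\<B> k)))"
proof -
  define c where "c = \<sigma> / sqrt (real (card (\<B> k)))"
  have card: "0 < real (card (\<B> k))" using batch[of k] by (simp add: card_gt_0_iff)
  have c: "0 < c" using \<sigma> card by (simp add: c_def)
  have c2: "c\<^sup>2 = \<sigma>\<^sup>2 / real (card (\<B> k))" using card by (simp add: c_def power_divide)
  have m: "e k \<in> borel_measurable M" unfolding e_def by (rule error_measurable)
  have e0: "0 \<le> e k \<omega>" for \<omega>
    unfolding e_def error_def by (rule dual_norm_nonneg[OF iterate_in_F])
  have nn: "(\<integral>\<^sup>+\<omega>. ennreal ((e k \<omega>)\<^sup>2) \<partial>M) \<le> ennreal (c\<^sup>2)"
    unfolding e_def c2 by (rule nn_error_bound)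
  have m2: "(\<lambda>\<omega>. (e k \<omega>)\<^sup>2) \<in> borel_measurable M" using m by measurable
  have i2: "integrable M (\<lambda>\<omega>. (e k \<omega>)\<^sup>2)"
  proof (rule integrableI_bounded[OF m2])
    show "(\<integral>\<^sup>+\<omega>. ennreal (norm ((e k \<omega>)\<^sup>2)) \<partial>M) < \<infinity>"
      using order.strict_trans1[OF nn ennreal_less_top] by simp
  qed
  have "ennreal (expectation (\<lambda>\<omega>. (e k \<omega>)\<^sup>2)) \<le> ennreal (c\<^sup>2)"
    using nn by (subst (asm) nn_integral_eq_integral[OF i2]) auto
  then have E2: "expectation (\<lambda>\<omega>. (e k \<omega>)\<^sup>2) \<le> c\<^sup>2" by (simp add: ennreal_le_iff)
  have amgm: "e k \<omega> \<le> (e k \<omega>)\<^sup>2 / (2 * c) + c / 2" for \<omega>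
  proof -
    have "0 \<le> (e k \<omega> - c)\<^sup>2" by simp
    then have "2 * c * e k \<omega> \<le> (e k \<omega>)\<^sup>2 + c\<^sup>2" by (simp add: power2_diff algebra_simps)
    then show ?thesis using c by (simp add: field_simps power2_eq_square)
  qed
  have ib: "integrable M (\<lambda>\<omega>. (e k \<omega>)\<^sup>2 / (2 * c) + c / 2)"
    using i2 by auto
  show int: "integrable M (e k)"
    by (rule Bochner_Integration.integrable_bound[OF ib m]) (use amgm e0 in \<open>auto intro: order.trans[OF _ abs_ge_self]\<close>)
  have "expectation (e k) \<le> expectation (\<lambda>\<omega>. (e k \<omega>)\<^sup>2 / (2 * c) + c / 2)"
    by (rule integral_mono[OF int ib amgm])
  also have "\<dots> = expectation (\<lambda>\<omega>. (e k \<omega>)\<^sup>2) / (2 * c) + c / 2"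
    using i2 by (simp add: prob_space)
  also have "\<dots> \<le> c\<^sup>2 / (2 * c) + c / 2"
    using E2 c by (intro add_mono divide_right_mono) auto
  also have "\<dots> = c" using c by (simp add: power2_eq_square)
  finally show "expectation (e k) \<le> \<sigma> / sqrt (real (card (\<B> k)))" by (simp add: c_def)
qed

lemma residual_nonneg: "0 \<le> residual k z"
  unfolding residual_def stationarity_def by (rule dual_norm_nonneg[OF iterate_in_F])

text \<open>In the pathwise bound all terms on the left are nonnegative, so a single residual is at
  most the integrable right-hand side divided by its positive step size. Integrating the bound then
  gives the sum.\<close>

lemma residual_expectation:
  shows "integrable M (\<lambda>\<omega>. residual k (path \<omega>))"
    and "(\<Sum>k<n. \<eta> k * expectation (\<lambda>\<omega>. residual k (path \<omega>)))
      \<le> init_gap f B \<phi>low x0 + 4 * \<sigma> * (\<Sum>k<n. \<eta> k / sqrt (real (card (\<B> k))))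
        + L\<phi> / 2 * (\<Sum>k<n. (\<eta> k)\<^sup>2)"
proof -
  let ?R = "\<lambda>k \<omega>. residual k (path \<omega>)"
  let ?e = "\<lambda>k \<omega>. error k (path \<omega>) (iterate k (path \<omega>))"
  let ?U = "\<lambda>n \<omega>. init_gap f B \<phi>low x0 + 4 * (\<Sum>k<n. \<eta> k * ?e k \<omega>) + L\<phi> / 2 * (\<Sum>k<n. (\<eta> k)\<^sup>2)"
  have bound: "(\<Sum>k<n. \<eta> k * ?R k \<omega>) \<le> ?U n \<omega>" for n \<omega>
    using sum_stationarity_bound[of "\<lambda>k. iterate k (path \<omega>)" \<eta> \<mu>
        "\<lambda>k. estimate k (path \<omega>) (iterate k (path \<omega>))" n]
    by (simp add: residual_def error_def x0 less_imp_le[OF \<eta>(1)] \<eta> \<mu>)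
  have iU: "integrable M (?U n)" for n
    using error_expectation(1) by (intro Bochner_Integration.integrable_add integrable_mult_right
        Bochner_Integration.integrable_sum integrable_const) auto
  show iR: "integrable M (?R k)" for k
  proof (rule Bochner_Integration.integrable_bound)
    show "integrable M (\<lambda>\<omega>. ?U (Suc k) \<omega> / \<eta> k)"
      by (rule integrable_divide_zero[OF iU])
    show "?R k \<in> borel_measurable M"
      by (rule measurable_compose[OF path_measurable measurable_residual])
    have "?R k \<omega> \<le> ?U (Suc k) \<omega> / \<eta> k" for \<omega>
    proof -
      have "\<eta> k * ?R k \<omega> \<le> (\<Sum>j<Suc k. \<eta> j * ?R j \<omega>)"
        using less_imp_le[OF \<eta>(1)] residual_nonneg by (intro member_le_sum) auto
      also have "\<dots> \<le> ?U (Suc k) \<omega>" by (rule bound)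
      finally show ?thesis using \<eta>(1)[of k] by (simp add: pos_le_divide_eq mult.commute)
    qed
    then show "AE \<omega> in M. norm (?R k \<omega>) \<le> norm (?U (Suc k) \<omega> / \<eta> k)"
      unfolding real_norm_def abs_of_nonneg[OF residual_nonneg]
      by (intro AE_I2) (rule order.trans[OF _ abs_ge_self])
  qed
  have "(\<Sum>k<n. \<eta> k * expectation (?R k)) = expectation (\<lambda>\<omega>. \<Sum>k<n. \<eta> k * ?R k \<omega>)"
    using iR by (simp add: Bochner_Integration.integral_sum)
  also have "\<dots> \<le> expectation (?U n)"
    using iR iU bound by (intro integral_mono Bochner_Integration.integrable_sum integrable_mult_right)
  also have "expectation (?U n) = init_gap f B \<phi>low x0
      + 4 * (\<Sum>k<n. \<eta> k * expectation (?e k)) + L\<phi> / 2 * (\<Sum>k<n. (\<eta> k)\<^sup>2)"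
    using error_expectation(1) by (simp add: Bochner_Integration.integral_sum prob_space)
  also have "(\<Sum>k<n. \<eta> k * expectation (?e k)) \<le> (\<Sum>k<n. \<eta> k * (\<sigma> / sqrt (real (card (\<B> k)))))"
    using error_expectation(2) less_imp_le[OF \<eta>(1)] by (intro sum_mono mult_left_mono) auto
  also have "\<dots> = \<sigma> * (\<Sum>k<n. \<eta> k / sqrt (real (card (\<B> k))))"
    by (simp add: sum_distrib_left mult_ac)
  finally show "(\<Sum>k<n. \<eta> k * expectation (?R k))
      \<le> init_gap f B \<phi>low x0 + 4 * \<sigma> * (\<Sum>k<n. \<eta> k / sqrt (real (card (\<B> k))))
        + L\<phi> / 2 * (\<Sum>k<n. (\<eta> k)\<^sup>2)" by (simp only: mult.assoc)
qed

end

section \<open>Random index and convergence rate\<close>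

text \<open>Almost surely the composite is the finite sum over \<open>k\<close> of
  \<open>r k (Z \<omega>)\<close> times the indicator of \<open>\<kappa> \<omega> = k\<close>.
  Independence factors each expectation, and each indicator has mean
  \<open>1 / card S\<close>.\<close>

lemma (in prob_space) expectation_random_index:
  fixes r :: "nat \<Rightarrow> 'c \<Rightarrow> real"
  assumes Z: "Z \<in> measurable M P" and \<kappa>: "\<kappa> \<in> measurable M (count_space UNIV)"
    and ind: "indep_set (sets (vimage_algebra (space M) Z P))
        (sets (vimage_algebra (space M) \<kappa> (count_space UNIV)))"
    and law: "distr M (count_space UNIV) \<kappa> = measure_pmf (pmf_of_set S)" and S: "finite S" "S \<noteq> {}"
    and r: "\<And>k. r k \<in> borel_measurable P" and int: "\<And>k. integrable M (\<lambda>\<omega>. r k (Z \<omega>))"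
  shows "AE \<omega> in M. \<kappa> \<omega> \<in> S"
    and "integrable M (\<lambda>\<omega>. r (\<kappa> \<omega>) (Z \<omega>))"
    and "expectation (\<lambda>\<omega>. r (\<kappa> \<omega>) (Z \<omega>)) = (\<Sum>k\<in>S. expectation (\<lambda>\<omega>. r k (Z \<omega>))) / real (card S)"
proof -
  have "AE k in distr M (count_space UNIV) \<kappa>. k \<in> S"
    unfolding law using S by (simp add: AE_measure_pmf_iff)
  then show inS: "AE \<omega> in M. \<kappa> \<omega> \<in> S"
    using \<kappa> by (subst (asm) AE_distr_iff) auto
  have iv: "indep_var borel (r k \<circ> Z) borel (indicat_real {k} \<circ> \<kappa>)" for k
    unfolding indep_var_eq
  proof (intro conjI)
    \<comment> \<open>Independence is assumed for the sigma-algebras generated by \<open>Z\<close>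
      and \<open>\<kappa>\<close>; measurable functions of them generate smaller ones.\<close>
    have gen: "sigma_sets (space M) {(h \<circ> W) -` A \<inter> space M |A. A \<in> sets borel}
        \<subseteq> sets (vimage_algebra (space M) W Q)"
      if "W \<in> measurable M Q" "h \<in> borel_measurable Q" for W :: "'a \<Rightarrow> 'd" and Q and h :: "'d \<Rightarrow> real"
    proof -
      have "W \<in> measurable (vimage_algebra (space M) W Q) Q"
        using measurable_space[OF that(1)] by (intro measurable_vimage_algebra1) auto
      then have "h \<circ> W \<in> borel_measurable (vimage_algebra (space M) W Q)"
        using that(2) by (rule measurable_comp)
      from sets_image_in_sets[OF _ this, of "space M"] show ?thesis
        by (simp add: sets_vimage_algebra)
    qed
    show "indep_set (sigma_sets (space M) {(r k \<circ> Z) -` A \<inter> space M |A. A \<in> sets borel})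
        (sigma_sets (space M) {(indicat_real {k} \<circ> \<kappa>) -` A \<inter> space M |A. A \<in> sets borel})"
      using ind gen[OF Z r[of k]] gen[OF \<kappa>, of "indicat_real {k}"]
      unfolding indep_sets2_eq by simp blast
  qed (use measurable_comp[OF Z r] measurable_comp[OF \<kappa>, of "indicat_real {k}" borel] in auto)
  have i: "integrable M (indicat_real {k} \<circ> \<kappa>)" "expectation (indicat_real {k} \<circ> \<kappa>) = 1 / real (card S)"
    if k: "k \<in> S" for k
  proof -
    show "integrable M (indicat_real {k} \<circ> \<kappa>)"
      using measurable_comp[OF \<kappa>, of "indicat_real {k}" borel]
      by (intro integrable_const_bound[of _ 1]) (auto simp: indicator_def)
    have "expectation (indicat_real {k} \<circ> \<kappa>) = (LINT j|distr M (count_space UNIV) \<kappa>. indicat_real {k} j)"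
      unfolding comp_def by (rule integral_distr[symmetric, OF \<kappa>]) simp
    also have "\<dots> = 1 / real (card S)"
      unfolding law using S k by (simp add: measure_pmf_single)
    finally show "expectation (indicat_real {k} \<circ> \<kappa>) = 1 / real (card S)" .
  qed
  define g where "g \<omega> = (\<Sum>k\<in>S. (r k \<circ> Z) \<omega> * (indicat_real {k} \<circ> \<kappa>) \<omega>)" for \<omega>
  have int': "integrable M (r k \<circ> Z)" for k using int by (simp add: comp_def)
  have gi: "integrable M (\<lambda>\<omega>. (r k \<circ> Z) \<omega> * (indicat_real {k} \<circ> \<kappa>) \<omega>)" if "k \<in> S" for k
    by (rule indep_var_integrable[OF iv int' i(1)[OF that]])
  have g: "integrable M g" unfolding g_def using gi by (intro Bochner_Integration.integrable_sum)
  have ae: "AE \<omega> in M. r (\<kappa> \<omega>) (Z \<omega>) = g \<omega>"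
    using inS
  proof eventually_elim
    case (elim \<omega>)
    have "g \<omega> = (\<Sum>k\<in>S. if k = \<kappa> \<omega> then r k (Z \<omega>) else 0)"
      unfolding g_def by (intro sum.cong) (auto simp: indicator_def)
    then show ?case using elim S by (simp add: sum.delta)
  qed
  have m: "(\<lambda>\<omega>. r (\<kappa> \<omega>) (Z \<omega>)) \<in> borel_measurable M"
    by (rule measurable_compose_countable[OF measurable_compose[OF Z r] \<kappa>])
  show "integrable M (\<lambda>\<omega>. r (\<kappa> \<omega>) (Z \<omega>))"
    using g ae m by (subst integrable_cong_AE[where g=g]) auto
  have "expectation (\<lambda>\<omega>. r (\<kappa> \<omega>) (Z \<omega>)) = expectation g"
    using g ae m by (intro integral_cong_AE) auto
  also have "\<dots> = (\<Sum>k\<in>S. expectation (\<lambda>\<omega>. (r k \<circ> Z) \<omega> * (indicat_real {k} \<circ> \<kappa>) \<omega>))"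
    unfolding g_def by (rule Bochner_Integration.integral_sum[OF gi])
  also have "\<dots> = (\<Sum>k\<in>S. expectation (r k \<circ> Z) * (1 / real (card S)))"
    by (intro sum.cong refl) (simp add: indep_var_lebesgue_integral[OF iv int' i(1)] i(2) del: comp_apply)
  finally show "expectation (\<lambda>\<omega>. r (\<kappa> \<omega>) (Z \<omega>)) = (\<Sum>k\<in>S. expectation (\<lambda>\<omega>. r k (Z \<omega>))) / real (card S)"
    by (simp add: comp_def sum_divide_distrib)
qed

text \<open>Every tail weight is at least \<open>s / u\<close> with \<open>u = sqrt N\<close>.
  Bounding the harmonic sum by \<open>2 * ln N\<close> turns the factor 4 of the error into 8 and
  cancels the 1/2 before \<open>L\<close>; writing \<open>ln N = 2 * ln u\<close> gives the outer 2
  in \<open>m\<close>.\<close>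

lemma tail_average_le:
  fixes E :: "nat \<Rightarrow> real"
  assumes E: "\<And>k. 0 \<le> E k" and c: "0 < c" and s: "0 < s" and N: "3 \<le> N"
    and nonneg: "0 \<le> \<Delta>" "0 < \<sigma>" "0 \<le> L"
    and sum: "(\<Sum>k<N. s / sqrt (real k + 1) * E k) \<le> \<Delta>
      + 4 * \<sigma> * (\<Sum>k<N. s / sqrt (real k + 1) / sqrt (real k + 1))
      + L / 2 * (\<Sum>k<N. (s / sqrt (real k + 1))\<^sup>2)"
  defines "m \<equiv> 2 * (\<Delta> / s + 8 * \<sigma> + s * L)"
  assumes large: "(4 * m * c * ln (4 * m * c))\<^sup>2 \<le> real N"
  shows "(\<Sum>k\<in>{N div 2..N - 1}. E k) / real (card {N div 2..N - 1}) \<le> 1 / c"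
proof -
  let ?S = "{N div 2..N - 1}"
  define u where "u = sqrt (real N)"
  have u: "1 < u" and u2: "u\<^sup>2 = real N" using N by (auto simp: u_def)
  have lnN: "ln (real N) = 2 * ln u" using N by (simp add: u_def ln_sqrt)
  have m: "0 < m" using nonneg s by (simp add: m_def add_nonneg_pos add_pos_nonneg)
  \<comment> \<open>Here \<open>N \<ge> 3\<close> enters, since 3 exceeds \<open>exp 1\<close>. It
    lets the constants 1 and \<open>\<Delta>\<close> be absorbed into logarithmic terms.\<close>
  have "1 \<le> ln (real N)"
    using N exp_le by (subst ln_exp[of 1, symmetric], subst ln_le_cancel_iff) auto
  define H where "H = (\<Sum>k<N. 1 / (real k + 1))"
  have H: "H \<le> 2 * ln (real N)"
    using sum_inverse_le_ln[of N] N \<open>1 \<le> ln (real N)\<close> by (simp add: H_def)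
  have sq: "s / sqrt (real k + 1) / sqrt (real k + 1) = s * (1 / (real k + 1))"
    "(s / sqrt (real k + 1))\<^sup>2 = s\<^sup>2 * (1 / (real k + 1))" for k
    by (simp_all add: power_divide)
  have "s / u * (\<Sum>k\<in>?S. E k) = (\<Sum>k\<in>?S. s / u * E k)" by (simp add: sum_distrib_left)
  also have "\<dots> \<le> (\<Sum>k\<in>?S. s / sqrt (real k + 1) * E k)"
  proof (intro sum_mono mult_right_mono divide_left_mono)
    fix k assume "k \<in> ?S"
    then show "sqrt (real k + 1) \<le> u" using N by (auto simp: u_def)
  qed (use s E u in auto)
  also have "\<dots> \<le> (\<Sum>k<N. s / sqrt (real k + 1) * E k)"
    using N s E by (intro sum_mono2) auto
  also have "\<dots> \<le> \<Delta> + 4 * \<sigma> * (s * H) + L / 2 * (s\<^sup>2 * H)"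
    using sum unfolding sq H_def sum_distrib_left[symmetric] .
  also have "\<dots> \<le> \<Delta> * ln (real N) + 4 * \<sigma> * (s * (2 * ln (real N))) + L / 2 * (s\<^sup>2 * (2 * ln (real N)))"
    using H nonneg s mult_left_mono[OF \<open>1 \<le> ln (real N)\<close> nonneg(1)]
    by (intro add_mono mult_left_mono) auto
  also have "\<dots> = s * (m * ln u)"
    using s by (simp add: m_def lnN field_simps power2_eq_square)
  finally have "(\<Sum>k\<in>?S. E k) \<le> u * (m * ln u)"
    using s u by (simp add: field_simps)
  \<comment> \<open>The 4 pays for the factor 2 in the logarithmic estimate and for the tail
    containing only about half of the \<open>N\<close> indices.\<close>
  moreover have "4 * m * c * ln u \<le> 2 * u"
  proof (rule mult_ln_le_of_ge[OF u])
    show "\<bar>4 * m * c * ln (4 * m * c)\<bar> \<le> u"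
      unfolding u_def using large by (rule real_le_rsqrt[of "\<bar>_\<bar>", unfolded power2_abs])
  qed (use m c in simp)
  then have "m * ln u \<le> u / (2 * c)" using c by (simp add: field_simps)
  then have "u * (m * ln u) \<le> u * (u / (2 * c))" using u by (intro mult_left_mono) auto
  moreover have "u * (u / (2 * c)) = real N / 2 * (1 / c)"
    using c u2 by (simp add: power2_eq_square field_simps)
  \<comment> \<open>The tail has \<open>N - N div 2\<close> indices, at least \<open>N / 2\<close>
    for either parity.\<close>
  moreover have "real N / 2 * (1 / c) \<le> real (card ?S) * (1 / c)"
    using N c by (intro mult_right_mono) (auto simp: of_nat_diff)
  ultimately have "(\<Sum>k\<in>?S. E k) \<le> real (card ?S) * (1 / c)" by linarith
  moreover have "0 < real (card ?S)" using N by auto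
  ultimately show ?thesis by (simp add: pos_divide_le_eq mult.commute)
qed

text \<open>The two main bounds on the horizon act separately: the first brings the barrier
  parameter to its floor on the whole tail, the second brings the averaged residual below that
  floor. As the index is random, comparison with its barrier parameter is an almost sure statement.
  Integrability belongs to the claim because the integral of a non-integrable function is 0 by
  convention.\<close>

theorem theorem2:
  fixes K :: "(real^'n) set" and A :: "real^'n^'m" and b :: "real^'m"
    and f B :: "real^'n \<Rightarrow> real" and \<theta> :: real
    and \<phi>low :: real and L1 :: "real \<Rightarrow> real" and \<sigma> :: real
    and s\<eta> \<epsilon> :: real and x0 :: "real^'n" and \<eta> \<mu> :: "nat \<Rightarrow> real"
    and D :: "'s measure" and G :: "real^'n \<Rightarrow> 's \<Rightarrow> real^'n"
    and M :: "'w measure" and \<B> :: "nat \<Rightarrow> 'i set" and \<xi> :: "nat \<Rightarrow> 'i \<Rightarrow> 'w \<Rightarrow> 's"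
    and m x :: "nat \<Rightarrow> 'w \<Rightarrow> real^'n" and lam :: "nat \<Rightarrow> 'w \<Rightarrow> real^'m"
    and N :: nat and \<kappa> :: "'w \<Rightarrow> nat"
  defines "\<Omega> \<equiv> feasible K A b" and "\<Omega>o \<equiv> strictly_feasible K A b"
    and "L\<phi> \<equiv> 2 * L1 s\<eta> + 1 / (1 - s\<eta>)"
    and "I \<equiv> Sigma UNIV \<B>"
  defines "Mme \<equiv> 2 * (init_gap f B \<phi>low x0 / s\<eta> + 8 * \<sigma> + s\<eta> * L\<phi>)"
  \<comment> \<open>problem and barrier\<close>
  assumes cone: "proper_cone K"
    and full_row_rank: "rank A = CARD('m)"
    and f_C1: "C_diff_on 1 f \<Omega>"
    and optimal: "\<exists>xs\<in>\<Omega>. \<forall>y\<in>\<Omega>. f xs \<le> f y"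
    and theta: "\<theta> \<ge> 1"
    and barrier: "LHSC_barrier K \<theta> B"
    and s_eta: "0 < s\<eta>" "s\<eta> < 1"
  \<comment> \<open>assumption (a)\<close>
    and interior_nonempty: "\<Omega>o \<noteq> {}"
    and lower_bound: "\<And>y t. y \<in> \<Omega>o \<Longrightarrow> 0 < t \<Longrightarrow> t \<le> 1 \<Longrightarrow> \<phi>low \<le> f y + t * B y"
  \<comment> \<open>assumption (b)\<close>
    and L1_pos: "\<And>s. 0 < s \<Longrightarrow> s < 1 \<Longrightarrow> L1 s > 0"
    and Lipschitz: "\<And>s y z. 0 < s \<Longrightarrow> s < 1 \<Longrightarrow> y \<in> \<Omega>o \<Longrightarrow> z \<in> \<Omega>o \<Longrightarrow>
        local_norm B y (z - y) \<le> s \<Longrightarrow>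
        dual_norm B y (grad f z - grad f y) \<le> L1 s * local_norm B y (z - y)"
  \<comment> \<open>assumption (c); \<open>D\<close> is the law of the random variable that is sampled\<close>
    and D_prob: "prob_space D"
    and sigma: "\<sigma> > 0"
    and G_measurable: "(\<lambda>(y, s). G y s) \<in> borel_measurable (restrict_space borel \<Omega>o \<Otimes>\<^sub>M D)"
    and G_unbiased: "\<And>y. y \<in> \<Omega>o \<Longrightarrow>
        integrable D (G y) \<and> (LINT s|D. G y s) = grad f y"
    and G_variance: "\<And>y. y \<in> \<Omega>o \<Longrightarrow>
        integrable D (\<lambda>s. (dual_norm B y (G y s - grad f y))\<^sup>2) \<and>
        (LINT s|D. (dual_norm B y (G y s - grad f y))\<^sup>2) \<le> \<sigma>\<^sup>2"
  \<comment> \<open>input parameters\<close>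
    and eps: "0 < \<epsilon>" "\<epsilon> < 1"
    and x0: "x0 \<in> \<Omega>o"
    and eta: "\<And>k. \<eta> k = s\<eta> / sqrt (real k + 1)"
    and batch: "\<And>k. finite (\<B> k) \<and> card (\<B> k) = k + 1"
    and mu: "\<And>k. \<mu> k = max (1 / sqrt (real k + 1)) (\<epsilon> / (1 + sqrt \<theta>))"
  \<comment> \<open>the samples: independent copies with law \<open>D\<close>\<close>
    and M_prob: "prob_space M"
    and xi_law: "\<And>k i. i \<in> \<B> k \<Longrightarrow> \<xi> k i \<in> M \<rightarrow>\<^sub>M D \<and> distr M D (\<xi> k i) = D"
    and xi_indep: "prob_space.indep_vars M (\<lambda>_. D) (\<lambda>(k, i). \<xi> k i) I"
  \<comment> \<open>the iterates\<close>
    and run: "\<And>\<omega>. \<omega> \<in> space M \<Longrightarrow>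
        SIPM_run A B \<eta> \<mu> x0 (\<lambda>k. minibatch G (\<B> k) (\<lambda>i. \<xi> k i \<omega>) (x k \<omega>))
          (\<lambda>k. m k \<omega>) (\<lambda>k. lam k \<omega>) (\<lambda>k. x k \<omega>)"
    and well_defined: "AE \<omega> in M. \<forall>k. m k \<omega> + transpose A *v lam k \<omega> \<noteq> 0"
  \<comment> \<open>the random index, for horizon \<open>N\<close>\<close>
    and N_large: "real N \<ge> Max {2 * ((1 + sqrt \<theta>) / \<epsilon>)\<^sup>2,
        (4 * Mme * (1 + sqrt \<theta>) / \<epsilon> * ln (4 * Mme * (1 + sqrt \<theta>) / \<epsilon>))\<^sup>2, 3}"
    and kappa_measurable: "\<kappa> \<in> M \<rightarrow>\<^sub>M count_space UNIV"
    and kappa_uniform: "distr M (count_space UNIV) \<kappa> = measure_pmf (pmf_of_set {N div 2..N - 1})"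
    and kappa_indep: "prob_space.indep_set M
        (sets (vimage_algebra (space M) (\<lambda>\<omega>. \<lambda>(k, i)\<in>I. \<xi> k i \<omega>) (PiM I (\<lambda>_. D))))
        (sets (vimage_algebra (space M) \<kappa> (count_space UNIV)))"
  defines "R \<equiv> (\<lambda>\<omega>. dual_norm B (x (\<kappa> \<omega>) \<omega>)
      (grad (barrier_fun f B (\<mu> (\<kappa> \<omega>))) (x (\<kappa> \<omega>) \<omega>) + transpose A *v lam (\<kappa> \<omega>) \<omega>))"
  shows "integrable M R \<and>
    (AE \<omega> in M. prob_space.expectation M R \<le> \<mu> (\<kappa> \<omega>) \<and> \<mu> (\<kappa> \<omega>) \<le> \<epsilon> / (1 + sqrt \<theta>))"
proof -
  interpret prob_space M by (rule M_prob)
  let ?X = "\<lambda>(k, i). \<xi> k i"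
  have \<mu>_pos: "0 < \<mu> k" for k unfolding mu by (simp add: less_max_iff_disj)
  have eps_le: "\<epsilon> / (1 + sqrt \<theta>) \<le> 1"
  proof -
    have "\<epsilon> \<le> 1 + sqrt \<theta>" "0 < 1 + sqrt \<theta>" using eps theta real_sqrt_ge_zero[of \<theta>] by linarith+
    then show ?thesis by simp
  qed
  have \<mu>_le: "\<mu> k \<le> 1" for k
    unfolding mu using eps_le by (simp add: field_simps)
  have \<mu>_dec: "\<mu> (Suc k) \<le> \<mu> k" for k
  proof -
    have "1 / sqrt (real (Suc k) + 1) \<le> 1 / sqrt (real k + 1)" by (intro divide_left_mono) auto
    then show ?thesis unfolding mu by linarith
  qed
  have batch_ne: "\<B> k \<noteq> {}" for k using batch[of k] by auto
  interpret S: stochastic_SIPM K \<theta> B A b f \<phi>low "L1 s\<eta>" s\<eta> M x0 \<eta> \<mu> D G \<B> ?X \<sigma>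
  proof unfold_locales
    show "0 < \<eta> k" for k using s_eta by (simp add: eta)
    show "\<eta> k \<le> s\<eta>" for k using s_eta by (simp add: eta field_simps)
    show "dual_norm B y (grad f z - grad f y) \<le> L1 s\<eta> * local_norm B y (z - y)"
      if "y \<in> strictly_feasible K A b" "z \<in> strictly_feasible K A b" "local_norm B y (z - y) \<le> s\<eta>" for y z
      using Lipschitz[OF s_eta] that by (simp add: \<Omega>o_def)
    show "distr M D (?X p) = D" if "p \<in> Sigma UNIV \<B>" for p
      using that xi_law by (cases p) simp
  qed (fact cone barrier full_row_rank f_C1[unfolded \<Omega>_def] s_eta less_imp_le[OF L1_pos[OF s_eta]]
      lower_bound[unfolded \<Omega>o_def] x0[unfolded \<Omega>o_def] \<mu>_pos \<mu>_le \<mu>_dec sigma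
      G_measurable[unfolded \<Omega>o_def] G_unbiased[unfolded \<Omega>o_def] G_variance[unfolded \<Omega>o_def]
      batch[THEN conjunct1] batch_ne xi_indep[unfolded I_def])+
  \<comment> \<open>A batch reads only coordinates inside the index set, where restriction changes
    nothing.\<close>
  have est: "minibatch G (\<B> k) (\<lambda>i. \<xi> k i \<omega>) y = S.estimate k (S.path \<omega>) y" for k \<omega> y
    unfolding S.estimate_def minibatch_def by (simp cong: sum.cong)
  note run' = run[unfolded SIPM_run_iff est]
  have x_eq: "x k \<omega> = S.iterate k (S.path \<omega>)" if \<omega>: "\<omega> \<in> space M" for k \<omega>
  proof (induction k)
    case 0
    show ?case using run'[OF \<omega>] by (simp only: S.iterate.simps)
  next
    case (Suc k)
    have "x (Suc k) \<omega> = SIPM_step B A (\<eta> k) (\<mu> k) (x k \<omega>) (S.estimate k (S.path \<omega>) (x k \<omega>))"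
      using run'[OF \<omega>] by blast
    then show ?case by (simp only: S.iterate.simps Suc.IH)
  qed
  have R_eq: "R \<omega> = S.residual (\<kappa> \<omega>) (S.path \<omega>)" if \<omega>: "\<omega> \<in> space M" for \<omega>
  proof -
    have "lam k \<omega> = multiplier B A (\<mu> k) (x k \<omega>) (S.estimate k (S.path \<omega>) (x k \<omega>))" for k
      using run'[OF \<omega>] by blast
    then show ?thesis by (simp only: R_def S.residual_def stationarity_def x_eq[OF \<omega>])
  qed
  have bounds: "2 * ((1 + sqrt \<theta>) / \<epsilon>)\<^sup>2 \<le> real N"
    "(4 * Mme * (1 + sqrt \<theta>) / \<epsilon> * ln (4 * Mme * (1 + sqrt \<theta>) / \<epsilon>))\<^sup>2 \<le> real N"
    "3 \<le> N"
    using N_large by auto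
  define c where "c = (1 + sqrt \<theta>) / \<epsilon>"
  have c: "0 < c" using eps theta by (simp add: c_def add_pos_nonneg)
  have path_eq: "(\<lambda>\<omega>. \<lambda>(k, i)\<in>I. \<xi> k i \<omega>) = S.path"
    by (auto simp: fun_eq_iff I_def restrict_def)
  have path_measurable: "S.path \<in> measurable M (PiM I (\<lambda>_. D))"
    using S.path_measurable by (simp add: I_def)
  let ?S = "{N div 2..N - 1}"
  have S_ne: "?S \<noteq> {}" using bounds(3) by auto
  note idx = expectation_random_index[OF path_measurable kappa_measurable
      kappa_indep[unfolded path_eq] kappa_uniform finite_atLeastAtMost S_ne,
      where r = S.residual, OF S.measurable_residual[folded I_def] S.residual_expectation(1)]
  have "integrable M R"
    using idx(2) by (subst Bochner_Integration.integrable_cong[OF refl R_eq])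
  moreover have "AE \<omega> in M. expectation R \<le> \<mu> (\<kappa> \<omega>) \<and> \<mu> (\<kappa> \<omega>) \<le> \<epsilon> / (1 + sqrt \<theta>)"
  proof -
    have "expectation R = (\<Sum>k\<in>?S. expectation (\<lambda>\<omega>. S.residual k (S.path \<omega>))) / real (card ?S)"
      unfolding idx(3)[symmetric] by (rule Bochner_Integration.integral_cong[OF refl R_eq])
    also have "\<dots> \<le> 1 / c"
    proof (rule tail_average_le[where \<Delta> = "init_gap f B \<phi>low x0" and \<sigma> = \<sigma> and s = s\<eta> and L = L\<phi>])
      show "0 \<le> expectation (\<lambda>\<omega>. S.residual k (S.path \<omega>))" for k
        by (rule Bochner_Integration.integral_nonneg) (rule S.residual_nonneg)
      show "0 \<le> init_gap f B \<phi>low x0" by (rule S.init_gap_nonneg[OF S.x0])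
      show "0 \<le> L\<phi>" using L1_pos[OF s_eta] s_eta by (simp add: L\<phi>_def)
      show "(\<Sum>k<N. s\<eta> / sqrt (real k + 1) * expectation (\<lambda>\<omega>. S.residual k (S.path \<omega>)))
          \<le> init_gap f B \<phi>low x0
            + 4 * \<sigma> * (\<Sum>k<N. s\<eta> / sqrt (real k + 1) / sqrt (real k + 1))
            + L\<phi> / 2 * (\<Sum>k<N. (s\<eta> / sqrt (real k + 1))\<^sup>2)"
        using S.residual_expectation(2)[of N] batch by (simp add: eta S.L\<phi>_def L\<phi>_def add.commute)
      show "(4 * (2 * (init_gap f B \<phi>low x0 / s\<eta> + 8 * \<sigma> + s\<eta> * L\<phi>)) * c
          * ln (4 * (2 * (init_gap f B \<phi>low x0 / s\<eta> + 8 * \<sigma> + s\<eta> * L\<phi>)) * c))\<^sup>2 \<le> real N"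
        using bounds(2) by (simp add: Mme_def c_def)
    qed (use c s_eta sigma bounds(3) in auto)
    finally have ER: "expectation R \<le> \<epsilon> / (1 + sqrt \<theta>)" by (simp add: c_def)
    have \<mu>_tail: "\<mu> k = \<epsilon> / (1 + sqrt \<theta>)" if k: "k \<in> ?S" for k
    proof -
      \<comment> \<open>The shift by 1 in the parameter compensates the rounding in
        \<open>N div 2\<close>.\<close>
      have "real N / 2 \<le> real k + 1" using k by (auto simp: field_simps)
      then have "c\<^sup>2 \<le> real k + 1" using bounds(1) unfolding c_def by linarith
      then have "c \<le> sqrt (real k + 1)" by (rule real_le_rsqrt)
      then have "1 / sqrt (real k + 1) \<le> 1 / c" using c by (intro divide_left_mono) auto
      then show ?thesis by (simp add: mu c_def)
    qed
    show ?thesis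
      using idx(1) by eventually_elim (use ER \<mu>_tail in simp)
  qed
  ultimately show ?thesis by blast
qed

end
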